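(* Let $(S,\bullet)$ be a pseudocompact Tychonoff semitopological monoid whose multiplication $\bullet : S\times S\to S$ is quasicontinuous, and let $G$ be a subgroup of $S$. Then $G$, with the subspace topology, is a topological group.
   Context: A space is pseudocompact if every real-valued continuous function on it is bounded. A semitopological monoid is a semigroup with an identity, endowed with a topology such that the multiplication is separately continuous (continuous in each variable when the other is fixed). A subgroup of a semigroup $S$ is a subset that is a group under the multiplication of $S$. A function $f : A\to B$ between topological spaces is quasicontinuous if for every $a\in A$, every open $V\subset B$ with $f(a)\in V$ and every open $U\subset A$ with $a\in U$ there is a nonempty open $W\subset U$ with $f(W)\subset V$; for $\bullet$ this refers to the product topology on $S\times S$. *)

theory Defs
  imports "HOL-Analysis.Analysis" "HOL-Algebra.Group"
begin

definition pseudocompact_space :: "'a topology \<Rightarrow> bool" where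
  "pseudocompact_space X \<longleftrightarrow>
     (\<forall>f. continuous_map X euclideanreal f \<longrightarrow> bounded (f ` topspace X))"

definition tychonoff_space :: "'a topology \<Rightarrow> bool" where
  "tychonoff_space X \<longleftrightarrow> completely_regular_space X \<and> Hausdorff_space X"

definition quasicontinuous_map :: "'a topology \<Rightarrow> 'b topology \<Rightarrow> ('a \<Rightarrow> 'b) \<Rightarrow> bool" where
  "quasicontinuous_map X Y f \<longleftrightarrow>
     f \<in> topspace X \<rightarrow> topspace Y \<and>
     (\<forall>a \<in> topspace X. \<forall>V U. openin Y V \<and> f a \<in> V \<and> openin X U \<and> a \<in> U \<longrightarrow>
        (\<exists>W. openin X W \<and> W \<noteq> {} \<and> W \<subseteq> U \<and> f ` W \<subseteq> V))"

definition semitopological_monoid :: "'a topology \<Rightarrow> ('a, 'b) monoid_scheme \<Rightarrow> bool" where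
  "semitopological_monoid X S \<longleftrightarrow>
     monoid S \<and> carrier S = topspace X \<and>
     (\<forall>a \<in> carrier S. continuous_map X X (\<lambda>x. a \<otimes>\<^bsub>S\<^esub> x)) \<and>
     (\<forall>a \<in> carrier S. continuous_map X X (\<lambda>x. x \<otimes>\<^bsub>S\<^esub> a))"

definition topological_group :: "'a topology \<Rightarrow> ('a, 'b) monoid_scheme \<Rightarrow> bool" where
  "topological_group X G \<longleftrightarrow>
     group G \<and> carrier G = topspace X \<and>
     continuous_map (prod_topology X X) X (\<lambda>(x, y). x \<otimes>\<^bsub>G\<^esub> y) \<and>
     continuous_map X X (\<lambda>x. inv\<^bsub>G\<^esub> x)"

text \<open>A subgroup of a semigroup need not contain the identity of the ambient monoid (if there is
  one): its neutral element is an idempotent \<open>e\<close>.  The library's \<open>subgroup\<close> would force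
  \<open>e = \<one>\<^bsub>S\<^esub>\<close>, so the identity of the restricted structure is replaced
  as well.\<close>

definition restrict_monoid ::
    "('a, 'b) monoid_scheme \<Rightarrow> 'a set \<Rightarrow> 'a \<Rightarrow> ('a, 'b) monoid_scheme" where
  "restrict_monoid S G e = S\<lparr>carrier := G, one := e\<rparr>"

definition semigroup_subgroup :: "'a set \<Rightarrow> 'a \<Rightarrow> ('a, 'b) monoid_scheme \<Rightarrow> bool" where
  "semigroup_subgroup G e S \<longleftrightarrow> G \<subseteq> carrier S \<and> group (restrict_monoid S G e)"

end

theory Submission
  imports Defs
begin

text \<open>For continuous \<open>f : S \<rightarrow> \<real>\<close> consider \<open>F(x, y) = f(xy)\<close>, which is separately continuous and
  quasicontinuous.  Pseudocompactness makes \<open>F\<close> satisfy Grothendieck's double limit condition: if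
  it failed, quasicontinuity would let one replace the two offending sequences of points by
  sequences of open sets, and cluster points of these contradict separate continuity.
  Christensen's argument for Namioka's theorem then finds, inside \<open>G\<close>, a nonempty open \<open>U\<close>
  on which the functions \<open>F(u, \<cdot>)\<close> restricted to \<open>G\<close> differ uniformly by at most \<open>\<epsilon>\<close>.  Right translation by
  an element of \<open>G\<close> preserves the supremum norm over \<open>G\<close>, so \<open>U\<close> can be moved to the identity:
  \<open>\<bar>f(uy) - f(y)\<bar> \<le> \<epsilon>\<close> for all \<open>y \<in> G\<close> and \<open>u\<close> near \<open>e\<close>, which gives joint continuity and, with
  \<open>u = g\<^sup>-\<^sup>1x\<close> and \<open>y = x\<^sup>-\<^sup>1\<close>, continuity of the inverse at \<open>g\<close>.\<close>

section \<open>Cluster points of sequences of open sets\<close>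

definition cluster_point :: "'a topology \<Rightarrow> (nat \<Rightarrow> 'a set) \<Rightarrow> 'a \<Rightarrow> bool" where
  "cluster_point X W x \<longleftrightarrow>
     x \<in> topspace X \<and> (\<forall>U. openin X U \<and> x \<in> U \<longrightarrow> infinite {n. U \<inter> W n \<noteq> {}})"

text \<open>Pseudocompactness is used in this form, which speaks of open sets instead of functions
  and so applies to sequences built by recursion. \<open>cluster_point\<close> counts indices, so
  repeated sets are allowed.\<close>

definition feebly_compact_space :: "'a topology \<Rightarrow> bool" where
  "feebly_compact_space X \<longleftrightarrow>
     (\<forall>W. (\<forall>n. openin X (W n) \<and> W n \<noteq> {}) \<longrightarrow> (\<exists>x. cluster_point X W x))"

lemma feebly_compactE:
  assumes "feebly_compact_space X" "\<And>n. openin X (W n)" "\<And>n. W n \<noteq> {}"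
  obtains x where "cluster_point X W x"
  using assms unfolding feebly_compact_space_def by blast

text \<open>Passage to the limit: if \<open>g x\<close> were outside \<open>C\<close>, the preimage
  of the complement of \<open>C\<close> would be a neighbourhood of \<open>x\<close> missing all
  \<open>W n\<close> with \<open>n \<ge> N\<close>.\<close>

lemma cluster_point_closed:
  assumes x: "cluster_point X W x" and g: "continuous_map X euclideanreal g"
    and C: "closed C" and W: "\<And>n w. n \<ge> N \<Longrightarrow> w \<in> W n \<Longrightarrow> g w \<in> C"
  shows "g x \<in> C"
proof (rule ccontr)
  assume "g x \<notin> C"
  let ?U = "{u \<in> topspace X. g u \<in> - C}"
  have "openin X ?U"
    using g C by (intro openin_continuous_map_preimage) auto
  moreover have "x \<in> ?U"
    using x \<open>g x \<notin> C\<close> by (auto simp: cluster_point_def)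
  ultimately have "infinite {n. ?U \<inter> W n \<noteq> {}}"
    using x unfolding cluster_point_def by blast
  then obtain n where "n \<ge> N" "?U \<inter> W n \<noteq> {}"
    unfolding infinite_nat_iff_unbounded_le by blast
  then show False using W by blast
qed

text \<open>A sequence without cluster points is locally finite. Complete regularity puts a bump of
  height 1 inside each \<open>W n\<close>, and the sum of the bumps with weights \<open>n\<close> is
  then continuous and unbounded.\<close>

lemma pseudocompact_imp_feebly_compact:
  assumes ps: "pseudocompact_space X" and cr: "completely_regular_space X"
  shows "feebly_compact_space X"
  unfolding feebly_compact_space_def
proof (intro allI impI, rule ccontr)
  fix W :: "nat \<Rightarrow> 'a set"
  assume W: "\<forall>n. openin X (W n) \<and> W n \<noteq> {}" and no: "\<nexists>x. cluster_point X W x"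
  obtain w where w: "\<And>n. w n \<in> W n"
    using W by (meson ex_in_conv)
  have wX: "w n \<in> topspace X" for n
    using w W openin_subset by blast
  have "\<exists>f. continuous_map X euclideanreal f \<and> f (w n) = 1 \<and>
            (\<forall>x\<in>topspace X - W n. f x = 0) \<and> (\<forall>x\<in>topspace X. 0 \<le> f x)" for n
  proof -
    have "closedin X (topspace X - W n)" "w n \<in> topspace X - (topspace X - W n)"
      using W w wX by auto
    with cr obtain f :: "'a \<Rightarrow> real" where
      f: "continuous_map X (top_of_set {0..1}) f" "f (w n) = 0" "f ` (topspace X - W n) \<subseteq> {1}"
      unfolding completely_regular_space_def by blast
    from f(1) have c: "continuous_map X euclideanreal f" and r: "f \<in> topspace X \<rightarrow> {0..1}"
      by (auto simp: continuous_map_in_subtopology)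
    show ?thesis
      using c r f(2,3) by (intro exI[of _ "\<lambda>x. 1 - f x"] conjI continuous_intros) fastforce+
  qed
  then obtain f where f: "\<And>n. continuous_map X euclideanreal (f n)" "\<And>n. f n (w n) = 1"
    "\<And>n x. x \<in> topspace X \<Longrightarrow> x \<notin> W n \<Longrightarrow> f n x = 0" "\<And>n x. x \<in> topspace X \<Longrightarrow> 0 \<le> f n x"
    by (metis Diff_iff)
  have "\<exists>U. openin X U \<and> x \<in> U \<and> finite {n. U \<inter> W n \<noteq> {}}" if "x \<in> topspace X" for x
    using no that unfolding cluster_point_def by blast
  then obtain U where U: "\<And>x. x \<in> topspace X \<Longrightarrow> openin X (U x) \<and> x \<in> U x \<and> finite {n. U x \<inter> W n \<noteq> {}}"
    by metis
  define J where "J x = {n. U x \<inter> W n \<noteq> {}}" for x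
  \<comment> \<open>The index set varies with the point, but on \<open>U x\<close> it may be
    enlarged to the fixed finite set \<open>J x\<close>, as the added terms vanish. So
    \<open>g\<close> is pasted together from finite sums.\<close>
  define g where "g x = (\<Sum>n\<in>{n. x \<in> W n}. real n * f n x)" for x
  have geq: "g z = (\<Sum>n\<in>J x. real n * f n z)" if "x \<in> topspace X" "z \<in> U x" for x z
    unfolding g_def
  proof (rule sum.mono_neutral_left)
    have "z \<in> topspace X" using U that openin_subset by blast
    then show "\<forall>i\<in>J x - {n. z \<in> W n}. real i * f i z = 0" using f(3) by auto
  qed (use U that in \<open>auto simp: J_def\<close>)
  have "continuous_map X euclideanreal g"
  proof (rule pasting_lemma[where I = "topspace X" and T = U and f = "\<lambda>x z. \<Sum>n\<in>J x. real n * f n z"])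
    show "continuous_map (subtopology X (U x)) euclideanreal (\<lambda>z. \<Sum>n\<in>J x. real n * f n z)"
      if "x \<in> topspace X" for x
      using U[OF that] f(1)
      by (intro continuous_map_sum continuous_map_real_mult_left continuous_map_from_subtopology)
         (auto simp: J_def)
    show "(\<Sum>n\<in>J i. real n * f n x) = (\<Sum>n\<in>J j. real n * f n x)"
      if "i \<in> topspace X" "j \<in> topspace X" "x \<in> topspace X \<inter> U i \<inter> U j" for i j x
      using that geq[of i x] geq[of j x] by simp
    show "\<exists>j. j \<in> topspace X \<and> x \<in> U j \<and> g x = (\<Sum>n\<in>J j. real n * f n x)"
      if "x \<in> topspace X" for x
      using that geq[of x x] U by blast
  qed (use U in blast)
  with ps obtain B where B: "\<And>x. x \<in> topspace X \<Longrightarrow> \<bar>g x\<bar> \<le> B"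
    unfolding pseudocompact_space_def bounded_iff by fastforce
  have "real n \<le> B" for n
  proof -
    have fin: "finite {m. w n \<in> W m}"
      using U[OF wX[of n]] by (rule_tac finite_subset[of _ "{m. U (w n) \<inter> W m \<noteq> {}}"]) auto
    have "real n * f n (w n) \<le> g (w n)"
      unfolding g_def by (rule member_le_sum) (use fin w f(4) wX in auto)
    then show ?thesis using f(2) B[OF wX[of n]] by (simp add: abs_le_iff)
  qed
  then show False using reals_Archimedean2[of B] by (meson not_less)
qed

section \<open>Finite conditions and pointwise cluster functions\<close>

lemma openin_Collect_finite_ball:
  assumes "finite K" "\<And>k. k \<in> K \<Longrightarrow> openin X {x \<in> topspace X. Q k x}"
  shows "openin X {x \<in> topspace X. \<forall>k\<in>K. Q k x}"
  using assms
proof (induction K)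
  case (insert k K)
  then have "openin X ({x \<in> topspace X. Q k x} \<inter> {x \<in> topspace X. \<forall>k\<in>K. Q k x})"
    by blast
  also have "\<dots> = {x \<in> topspace X. \<forall>i\<in>insert k K. Q i x}"
    by blast
  finally show ?case .
qed simp

lemma open_dist_real: "open {r::real. \<bar>r - c\<bar> < d}" "open {r::real. \<bar>r - c\<bar> > d}"
  by (intro open_Collect_less continuous_intros)+

lemma closed_dist_real: "closed {r::real. \<bar>r - c\<bar> \<le> d}" "closed {r::real. \<bar>r - c\<bar> \<ge> d}"
  by (intro closed_Collect_le continuous_intros)+

text \<open>By Tychonoff's theorem the cube of all functions into \<open>{-M..M}\<close> is compact,
  so the closures of the tails of the sequence share a point \<open>h\<close>. No subsequence need
  converge to \<open>h\<close>, hence the formulation with finite sets \<open>Z\<close> and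
  tails.\<close>

lemma pointwise_cluster:
  fixes \<phi> :: "nat \<Rightarrow> 'c \<Rightarrow> real"
  assumes bound: "\<And>n c. \<bar>\<phi> n c\<bar> \<le> M"
  obtains h where "\<And>Z \<eta> N. finite Z \<Longrightarrow> \<eta> > 0 \<Longrightarrow> \<exists>n\<ge>N. \<forall>z\<in>Z. \<bar>\<phi> n z - h z\<bar> < \<eta>"
proof -
  define T where "T = product_topology (\<lambda>_::'c. top_of_set {-M..M}) UNIV"
  have T: "topspace T = UNIV \<rightarrow>\<^sub>E {-M..M}" by (simp add: T_def)
  have comp: "compact_space T"
    unfolding T_def compact_space_product_topology
    by (simp add: compact_space_subtopology compactin_euclidean_iff)
  have phi: "\<phi> n \<in> topspace T" for n
    using bound[of n] by (force simp: T abs_le_iff)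
  define C where "C N = T closure_of (\<phi> ` {N..})" for N
  have fip: "\<Inter>\<F> \<noteq> {}" if \<F>: "finite \<F>" "\<F> \<subseteq> range C" for \<F>
  proof -
    obtain I where I: "finite I" "\<F> = C ` I" using finite_subset_image[OF \<F>] by blast
    obtain n where n: "\<And>i. i \<in> I \<Longrightarrow> i \<le> n" using I(1) unfolding finite_nat_set_iff_bounded_le by blast
    have "\<phi> n \<in> C i" if "i \<in> I" for i
      unfolding C_def using n[OF that] phi by (intro subsetD[OF closure_of_subset]) auto
    then show ?thesis using I by blast
  qed
  have "\<Inter>(range C) \<noteq> {}"
    using comp fip unfolding compact_space_fip by (auto simp: C_def)
  then obtain h where h: "\<And>N. h \<in> C N" by blast
  show ?thesis
  proof (rule that)
    fix Z :: "'c set" and \<eta> :: real and N :: nat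
    assume Z: "finite Z" and eta: "\<eta> > 0"
    define D where "D = {f \<in> topspace T. \<forall>z\<in>Z. f z \<in> ball (h z) \<eta>}"
    have "continuous_map T euclideanreal (\<lambda>f. f z)" for z
      using continuous_map_product_projection[of z UNIV "\<lambda>_::'c. top_of_set {-M..M}"]
      by (auto simp: T_def continuous_map_in_subtopology)
    then have "openin T D"
      unfolding D_def using Z
      by (intro openin_Collect_finite_ball openin_continuous_map_preimage) auto
    moreover have "h \<in> D"
      using h[of N] eta by (auto simp: D_def C_def in_closure_of)
    ultimately obtain f where "f \<in> D" "f \<in> \<phi> ` {N..}"
      using h[of N] unfolding C_def in_closure_of by blast
    then show "\<exists>n\<ge>N. \<forall>z\<in>Z. \<bar>\<phi> n z - h z\<bar> < \<eta>"
      by (auto simp: D_def dist_real_def abs_minus_commute)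
  qed
qed

section \<open>Double limits of separately continuous quasicontinuous functions\<close>

text \<open>Abstracts the properties of \<open>f(xy)\<close>. The hypotheses are symmetric in the
  two variables, so every result may also be used with their roles exchanged. Quasicontinuity is
  phrased with boxes.\<close>

locale quasi_sep =
  fixes X :: "'a topology" and Y :: "'b topology" and F :: "'a \<Rightarrow> 'b \<Rightarrow> real"
  assumes fcX: "feebly_compact_space X" and fcY: "feebly_compact_space Y"
    and cont1: "\<And>y. y \<in> topspace Y \<Longrightarrow> continuous_map X euclideanreal (\<lambda>x. F x y)"
    and cont2: "\<And>x. x \<in> topspace X \<Longrightarrow> continuous_map Y euclideanreal (\<lambda>y. F x y)"
    and quasi: "\<And>x y U V T. openin X U \<Longrightarrow> x \<in> U \<Longrightarrow> openin Y V \<Longrightarrow> y \<in> V \<Longrightarrow> open T \<Longrightarrow> F x y \<in> T \<Longrightarrow>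
       \<exists>W V'. openin X W \<and> W \<noteq> {} \<and> W \<subseteq> U \<and> openin Y V' \<and> V' \<noteq> {} \<and> V' \<subseteq> V \<and>
         (\<forall>w\<in>W. \<forall>v\<in>V'. F w v \<in> T)"
begin

lemma quasi_sep_swap: "quasi_sep Y X (\<lambda>y x. F x y)"
proof
  show "\<exists>W V'. openin Y W \<and> W \<noteq> {} \<and> W \<subseteq> U \<and> openin X V' \<and> V' \<noteq> {} \<and> V' \<subseteq> V \<and>
         (\<forall>w\<in>W. \<forall>v\<in>V'. F v w \<in> T)"
    if "openin Y U" "x \<in> U" "openin X V" "y \<in> V" "open T" "F y x \<in> T" for x y U V T
    using quasi[OF that(3,4,1,2,5,6)] by metis
qed (use fcX fcY cont1 cont2 in auto)

text \<open>Quasicontinuity is applied once for each \<open>k\<close>. The first factor only shrinks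
  inside \<open>U\<close>, so the condition at the next \<open>z k\<close> still holds at each of
  its points and the earlier conditions persist. The new \<open>V' k\<close> may lose the point
  \<open>z k\<close>.\<close>

lemma finite_quasi:
  assumes "finite K" "openin X U" "U \<noteq> {}" "open T"
    and "\<And>k. k \<in> K \<Longrightarrow> openin Y (V k)" "\<And>k. k \<in> K \<Longrightarrow> z k \<in> V k"
    and "\<And>k u. k \<in> K \<Longrightarrow> u \<in> U \<Longrightarrow> F u (z k) \<in> T"
  shows "\<exists>W V'. openin X W \<and> W \<noteq> {} \<and> W \<subseteq> U \<and>
     (\<forall>k\<in>K. openin Y (V' k) \<and> V' k \<noteq> {} \<and> V' k \<subseteq> V k \<and> (\<forall>w\<in>W. \<forall>v\<in>V' k. F w v \<in> T))"
  using assms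
proof (induction K)
  case empty
  then show ?case by blast
next
  case (insert k K)
  have "\<exists>W V'. openin X W \<and> W \<noteq> {} \<and> W \<subseteq> U \<and>
     (\<forall>k\<in>K. openin Y (V' k) \<and> V' k \<noteq> {} \<and> V' k \<subseteq> V k \<and> (\<forall>w\<in>W. \<forall>v\<in>V' k. F w v \<in> T))"
    by (rule insert.IH) (use insert.prems in auto)
  then obtain W V' where W: "openin X W" "W \<noteq> {}" "W \<subseteq> U"
     "\<forall>k\<in>K. openin Y (V' k) \<and> V' k \<noteq> {} \<and> V' k \<subseteq> V k \<and> (\<forall>w\<in>W. \<forall>v\<in>V' k. F w v \<in> T)"
    by blast
  obtain w where w: "w \<in> W" using W by blast
  have "openin Y (V k)" "z k \<in> V k" "F w (z k) \<in> T"
    using insert.prems(4-6) W(3) w by auto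
  from quasi[OF W(1) w this(1,2) \<open>open T\<close> this(3)]
  obtain W2 V2 where W2: "openin X W2" "W2 \<noteq> {}" "W2 \<subseteq> W" "openin Y V2" "V2 \<noteq> {}" "V2 \<subseteq> V k"
    "\<forall>w\<in>W2. \<forall>v\<in>V2. F w v \<in> T"
    by blast
  have "\<forall>i\<in>insert k K. openin Y ((V'(k := V2)) i) \<and> (V'(k := V2)) i \<noteq> {} \<and>
      (V'(k := V2)) i \<subseteq> V i \<and> (\<forall>w\<in>W2. \<forall>v\<in>(V'(k := V2)) i. F w v \<in> T)"
    using W(4) W2(3-7) by (simp add: subset_iff)
  with W2(1-3) W(3) show ?case
    by (intro exI[of _ W2] exI[of _ "V'(k := V2)"] conjI) auto
qed

text \<open>Only the sets \<open>V k l\<close> depend on the stage \<open>l\<close>: once a cluster point \<open>x\<close> of the \<open>W j\<close> is fixed, feeble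
  compactness provides for each \<open>k\<close> a stage \<open>l\<close> at which \<open>F x\<close> stays away from \<open>A\<close> on \<open>V k l\<close>.\<close>

lemma no_staircase:
  fixes W :: "nat \<Rightarrow> 'a set" and V :: "nat \<Rightarrow> nat \<Rightarrow> 'b set"
  assumes W: "\<And>j. openin X (W j)" "\<And>j. W j \<noteq> {}"
    and V: "\<And>k l. k \<le> l \<Longrightarrow> openin Y (V k l)" "\<And>k l. k \<le> l \<Longrightarrow> V k l \<noteq> {}"
    and A: "closed A" "\<And>j k l w v. j \<le> k \<Longrightarrow> k \<le> l \<Longrightarrow> w \<in> W j \<Longrightarrow> v \<in> V k l \<Longrightarrow> F w v \<in> A"
    and B: "closed B" "\<And>j k l w v. k < j \<Longrightarrow> j < l \<Longrightarrow> w \<in> W j \<Longrightarrow> v \<in> V k l \<Longrightarrow> F w v \<in> B"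
    and AB: "A \<inter> B = {}"
  shows False
proof -
  \<comment> \<open>Disjoint open enlargements are taken because membership of \<open>F x v\<close>
    in \<open>OA\<close> is an open condition on \<open>v\<close>, to which feeble compactness can
    be applied.\<close>
  obtain OA OB where O: "open OA" "open OB" "A \<subseteq> OA" "B \<subseteq> OB" "OA \<inter> OB = {}"
    using separation_normal[OF A(1) B(1) AB] by blast
  obtain x where x: "cluster_point X W x" by (rule feebly_compactE[OF fcX W])
  then have xX: "x \<in> topspace X" by (simp add: cluster_point_def)
  have WX: "w \<in> topspace X" if "w \<in> W j" for w j using W(1) that openin_subset by blast
  have "\<exists>l\<ge>k. \<forall>v\<in>V k l. F x v \<notin> OA" for k
  proof (rule ccontr)
    assume "\<not> ?thesis"
    then have ne: "\<And>l. k \<le> l \<Longrightarrow> \<exists>v\<in>V k l. F x v \<in> OA" by blast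
    \<comment> \<open>Here \<open>k\<close> is fixed and the stage grows. At a cluster point
      \<open>y\<close> the value \<open>F x y\<close> avoids \<open>OB\<close>, yet every
      \<open>F w y\<close> with \<open>w\<close> in a late \<open>W j\<close> lies in
      \<open>B\<close>, and so does \<open>F x y\<close>.\<close>
    define V' where "V' i = {v \<in> topspace Y. F x v \<in> OA} \<inter> V k (k + i)" for i
    have "openin Y (V' i)" for i
      unfolding V'_def using cont2[OF xX] O(1) V(1)
      by (intro openin_Int openin_continuous_map_preimage) auto
    moreover have "V' i \<noteq> {}" for i
      unfolding V'_def using ne[of "k+i"] V(1)[of k "k+i"] openin_subset by fastforce
    ultimately obtain y where y: "cluster_point Y V' y" by (rule feebly_compactE[OF fcY])
    then have yY: "y \<in> topspace Y" by (simp add: cluster_point_def)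
    have "F x y \<in> - OB"
      by (rule cluster_point_closed[OF y cont2[OF xX], of _ 0]) (use O in \<open>auto simp: V'_def\<close>)
    moreover have "F w y \<in> B" if "w \<in> W j" "j \<ge> Suc k" for w j
      by (rule cluster_point_closed[OF y cont2[OF WX[OF that(1)]] B(1), of "Suc j"])
        (use that in \<open>auto simp: V'_def intro!: B(2)[of k j "k + n" w for n]\<close>)
    then have "F x y \<in> B"
      by (intro cluster_point_closed[OF x cont1[OF yY] B(1), of "Suc k"])
    ultimately show False using O by blast
  qed
  then obtain l where l: "\<And>k. l k \<ge> k" "\<And>k v. v \<in> V k (l k) \<Longrightarrow> F x v \<notin> OA" by metis
  \<comment> \<open>Now \<open>k\<close> grows along the stages \<open>l k\<close>. The value
    \<open>F x y\<close> avoids \<open>OA\<close>, while \<open>F w y\<close> lies in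
    \<open>A\<close> for all \<open>w\<close> in the sets \<open>W j\<close>, since
    \<open>j \<le> k\<close> holds eventually.\<close>
  obtain y where y: "cluster_point Y (\<lambda>k. V k (l k)) y"
    by (rule feebly_compactE[OF fcY, of "\<lambda>k. V k (l k)"]) (use V l(1) in auto)
  then have yY: "y \<in> topspace Y" by (simp add: cluster_point_def)
  have "F x y \<in> - OA"
    by (rule cluster_point_closed[OF y cont2[OF xX], of _ 0]) (use O l(2) in auto)
  moreover have "F w y \<in> A" if "w \<in> W j" for w j
    by (rule cluster_point_closed[OF y cont2[OF WX[OF that(1)]] A(1), of j])
      (use that l(1) in \<open>auto intro!: A(2)[of j n "l n" w for n]\<close>)
  then have "F x y \<in> A"
    by (intro cluster_point_closed[OF x cont1[OF yY] A(1), of 0])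
  ultimately show False using O by blast
qed

text \<open>Unlike in plain quasicontinuity, the set \<open>D\<close> contains the point \<open>y\<close> itself.\<close>

lemma strong_quasi:
  assumes U: "openin X U" "x \<in> U" and y: "y \<in> topspace Y" and eps: "\<epsilon> > 0"
  shows "\<exists>W D. openin X W \<and> W \<noteq> {} \<and> W \<subseteq> U \<and> openin Y D \<and> y \<in> D \<and>
           (\<forall>w\<in>W. \<forall>v\<in>D. \<bar>F w v - F x y\<bar> < \<epsilon>)"
proof (rule ccontr)
  assume contra: "\<not> ?thesis"
  define c where "c = F x y"
  \<comment> \<open>The gap between \<open>\<epsilon> / 3\<close> and
    \<open>2 * \<epsilon> / 3\<close> keeps the closed versions of the two conditions disjoint, as
    the staircase lemma demands.\<close>
  define Nr where "Nr = {r. \<bar>r - c\<bar> < \<epsilon> / 3}"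
  define Fr where "Fr = {r. \<bar>r - c\<bar> > 2 * \<epsilon> / 3}"
  have opn: "open Nr" "open Fr" unfolding Nr_def Fr_def by (rule open_dist_real)+
  define U0 where "U0 = {u \<in> topspace X. F u y \<in> Nr} \<inter> U"
  have "openin X {u \<in> topspace X. F u y \<in> Nr}"
    using opn cont1[OF y] by (intro openin_continuous_map_preimage) auto
  then have U0: "openin X U0" "x \<in> U0"
    unfolding U0_def using U openin_subset[OF U(1)] eps by (auto simp: Nr_def c_def)
  have far_ex: "\<exists>w\<in>W. \<exists>v\<in>D. F w v \<in> Fr"
    if "openin X W" "W \<noteq> {}" "W \<subseteq> U0" "openin Y D" "y \<in> D" for W D
  proof -
    have "W \<subseteq> U" using that unfolding U0_def by blast
    then have "\<not> (\<forall>w\<in>W. \<forall>v\<in>D. \<bar>F w v - F x y\<bar> < \<epsilon>)" using contra that by blast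
    then obtain w v where wv: "w \<in> W" "v \<in> D" "\<bar>F w v - c\<bar> \<ge> \<epsilon>"
      unfolding c_def by (meson not_less)
    then have "F w v \<in> Fr" unfolding Fr_def using eps by simp
    with wv show ?thesis by blast
  qed
  \<comment> \<open>A state consists of \<open>U\<close>, \<open>V\<close> and the sets
    \<open>W i\<close> with \<open>i \<le> n\<close>. Each step shrinks \<open>U\<close> and chooses
    \<open>V\<close> so that \<open>F\<close> is far from \<open>c\<close> on
    \<open>U \<times> V\<close>, shrinks the old \<open>W i\<close> so that \<open>F\<close> is near
    \<open>c\<close> on \<open>W i \<times> V\<close>, and takes the next \<open>W\<close> inside
    the new \<open>U\<close>.\<close>
  define P where "P n s \<longleftrightarrow> openin X (fst s) \<and> fst s \<noteq> {} \<and> fst s \<subseteq> U0 \<and>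
      openin Y (fst (snd s)) \<and> fst (snd s) \<noteq> {} \<and>
      (\<forall>i\<le>n. openin X (snd (snd s) i) \<and> snd (snd s) i \<noteq> {} \<and> snd (snd s) i \<subseteq> U0)"
    for n :: nat and s :: "'a set \<times> 'b set \<times> (nat \<Rightarrow> 'a set)"
  define Q where "Q n s s' \<longleftrightarrow> fst s' \<subseteq> fst s \<and> (\<forall>w\<in>fst s'. \<forall>v\<in>fst (snd s'). F w v \<in> Fr) \<and>
      (\<forall>i\<le>n. snd (snd s') i \<subseteq> snd (snd s) i \<and> (\<forall>w\<in>snd (snd s') i. \<forall>v\<in>fst (snd s'). F w v \<in> Nr)) \<and>
      snd (snd s') (Suc n) \<subseteq> fst s'"
    for n :: nat and s s' :: "'a set \<times> 'b set \<times> (nat \<Rightarrow> 'a set)"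
  have base: "P 0 (U0, topspace Y, \<lambda>_. U0)"
    unfolding P_def using U0 y by auto
  have step: "\<exists>s'. P (Suc n) s' \<and> Q n s s'" if Pn: "P n s" for n s
  proof -
    obtain U1 V1 W1 where s: "s = (U1, V1, W1)" by (cases s)
    have U1: "openin X U1" "U1 \<noteq> {}" "U1 \<subseteq> U0" and
      W1: "\<And>i. i \<le> n \<Longrightarrow> openin X (W1 i) \<and> W1 i \<noteq> {} \<and> W1 i \<subseteq> U0"
      using Pn by (auto simp: P_def s)
    obtain w where w: "\<And>i. i \<le> n \<Longrightarrow> w i \<in> W1 i" using W1 by (meson ex_in_conv)
    define O' where "O' = {v \<in> topspace Y. \<forall>i\<in>{..n}. F (w i) v \<in> Nr}"
    have "w i \<in> topspace X" if "i \<le> n" for i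
      using w W1 that openin_subset by blast
    then have O': "openin Y O'"
      unfolding O'_def using opn cont2
      by (intro openin_Collect_finite_ball openin_continuous_map_preimage) auto
    \<comment> \<open>The points \<open>w i\<close> lie in \<open>U0\<close>, so each
      \<open>F (w i) y\<close> is near \<open>c\<close>. Thus \<open>O'\<close> is a neighbourhood
      of \<open>y\<close>, and the assumed failure yields a far value over it.\<close>
    have "y \<in> O'"
      unfolding O'_def using w W1 y U0_def by blast
    then obtain w0 v0 where wv0: "w0 \<in> U1" "v0 \<in> O'" "F w0 v0 \<in> Fr" using far_ex U1 O' by meson
    from quasi[OF U1(1) wv0(1) O' wv0(2) opn(2) wv0(3)]
    obtain U2 V2 where U2: "openin X U2" "U2 \<noteq> {}" "U2 \<subseteq> U1" and
      V2: "openin Y V2" "V2 \<noteq> {}" "V2 \<subseteq> O'" and far: "\<forall>w\<in>U2. \<forall>v\<in>V2. F w v \<in> Fr"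
      by blast
    have "\<exists>V3 W3. openin Y V3 \<and> V3 \<noteq> {} \<and> V3 \<subseteq> V2 \<and> (\<forall>i\<in>{..n}. openin X (W3 i) \<and>
        W3 i \<noteq> {} \<and> W3 i \<subseteq> W1 i \<and> (\<forall>v\<in>V3. \<forall>w\<in>W3 i. F w v \<in> Nr))"
      by (rule quasi_sep.finite_quasi[OF quasi_sep_swap, of _ _ _ _ w])
        (use opn W1 w V2 in \<open>auto simp: O'_def\<close>)
    then obtain V3 W3 where V3: "openin Y V3" "V3 \<noteq> {}" "V3 \<subseteq> V2" and
      W3: "\<forall>i\<in>{..n}. openin X (W3 i) \<and> W3 i \<noteq> {} \<and> W3 i \<subseteq> W1 i \<and> (\<forall>v\<in>V3. \<forall>w\<in>W3 i. F w v \<in> Nr)"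
      by - (elim exE conjE, rule that)
    define s' where "s' = (U2, V3, W3(Suc n := U2))"
    have "W3 i \<subseteq> U0" if "i \<le> n" for i
      using W3 W1[OF that] that by (meson atMost_iff order_trans)
    then have "P (Suc n) s'"
      unfolding P_def s'_def fst_conv snd_conv using U2 U1(3) V3 W3 by (simp add: le_Suc_eq)
    moreover have "Q n s s'"
      unfolding Q_def s'_def s using U2 V3 W3 far by auto
    ultimately show ?thesis by blast
  qed
  obtain f where f: "\<And>n. P n (f n)" "\<And>n. Q n (f n) (f (Suc n))"
    using dependent_nat_choice[of P Q] base step by blast
  define Us where "Us n = fst (f n)" for n
  define Vs where "Vs n = fst (snd (f n))" for n
  define Ws where "Ws n = snd (snd (f n))" for n
  have fP: "openin Y (Vs n)" "Vs n \<noteq> {}" "i \<le> n \<Longrightarrow> openin X (Ws n i) \<and> Ws n i \<noteq> {}" for n i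
    using f(1)[of n] by (auto simp: P_def Vs_def Ws_def)
  have fQ: "Us (Suc n) \<subseteq> Us n" "w \<in> Us (Suc n) \<Longrightarrow> v \<in> Vs (Suc n) \<Longrightarrow> F w v \<in> Fr"
    "i \<le> n \<Longrightarrow> Ws (Suc n) i \<subseteq> Ws n i" "Ws (Suc n) (Suc n) \<subseteq> Us (Suc n)"
    "i \<le> n \<Longrightarrow> w \<in> Ws (Suc n) i \<Longrightarrow> v \<in> Vs (Suc n) \<Longrightarrow> F w v \<in> Nr" for n i w v
    using f(2)[of n] by (auto simp: Q_def Us_def Vs_def Ws_def)
  have Us: "Us l \<subseteq> Us j" if "j \<le> l" for j l
    using lift_Suc_antimono_le[of Us] fQ(1) that by blast
  have Ws: "Ws l i \<subseteq> Ws j i" if "j \<le> l" "i \<le> j" for i j l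
    using that
  proof (induction l rule: dec_induct)
    case (step l)
    then show ?case using fQ(3)[of i l] by force
  qed simp
  show False
  \<comment> \<open>The roles are exchanged: the \<open>V\<close> sets carry one index, the
    \<open>W\<close> sets an index and a stage. Indices start at \<open>Suc 0\<close> because the
    relations \<open>Q\<close> say nothing about the near or far values at stage 0.\<close>
  proof (rule quasi_sep.no_staircase[OF quasi_sep_swap, of "\<lambda>j. Vs (Suc j)" "\<lambda>k l. Ws (Suc l) (Suc k)"
        "{r. \<bar>r - c\<bar> \<ge> 2 * \<epsilon> / 3}" "{r. \<bar>r - c\<bar> \<le> \<epsilon> / 3}"])
    show "F v w \<in> {r. \<bar>r - c\<bar> \<ge> 2 * \<epsilon> / 3}"
      if "j \<le> k" "k \<le> l" "w \<in> Vs (Suc j)" "v \<in> Ws (Suc l) (Suc k)" for j k l w v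
    proof -
      have "v \<in> Us (Suc j)"
        using that Ws[of "Suc k" "Suc l" "Suc k"] fQ(4)[of k] Us[of "Suc j" "Suc k"] by auto
      then show ?thesis using fQ(2) that(3) by (fastforce simp: Fr_def)
    qed
    show "F v w \<in> {r. \<bar>r - c\<bar> \<le> \<epsilon> / 3}"
      if "k < j" "j < l" "w \<in> Vs (Suc j)" "v \<in> Ws (Suc l) (Suc k)" for j k l w v
    proof -
      have "v \<in> Ws (Suc j) (Suc k)"
        using that Ws[of "Suc j" "Suc l" "Suc k"] by auto
      then show ?thesis using fQ(5)[of "Suc k" j v w] that by (auto simp: Nr_def)
    qed
  qed (use fP eps closed_dist_real(1)[of c "\<epsilon> / 3"] closed_dist_real(2)[of "2 * \<epsilon> / 3" c] in auto)
qed

text \<open>The double limit condition for open sets: \<open>h\<close> is a pointwise limit of the \<open>F p\<close>, so \<open>a\<close> is the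
  value of one iterated limit while the other one stays \<open>t\<close> away from \<open>a\<close>.\<close>

lemma no_open_gap:
  fixes V :: "nat \<Rightarrow> 'b set"
  assumes P: "P \<subseteq> topspace X" and V: "\<And>n. openin Y (V n)" "\<And>n. V n \<noteq> {}" and st: "s < t"
    and near: "\<And>p. p \<in> P \<Longrightarrow> \<exists>N. \<forall>n\<ge>N. \<forall>v\<in>V n. \<bar>F p v - a\<bar> \<le> s"
    and clos: "\<And>Z \<eta>. finite Z \<Longrightarrow> Z \<subseteq> topspace Y \<Longrightarrow> \<eta> > 0 \<Longrightarrow> \<exists>p\<in>P. \<forall>z\<in>Z. \<bar>F p z - h z\<bar> < \<eta>"
    and dense: "\<And>n V'. openin Y V' \<Longrightarrow> V' \<noteq> {} \<Longrightarrow> V' \<subseteq> V n \<Longrightarrow> \<exists>z\<in>V'. \<bar>h z - a\<bar> \<ge> t"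
  shows False
proof -
  define \<eta> where "\<eta> = (t - s) / 3"
  have eta: "\<eta> > 0" "s + \<eta> < t - \<eta>" using st by (auto simp: \<eta>_def field_simps)
  \<comment> \<open>A state consists of an open set in \<open>X\<close>, the sets \<open>V k\<close>
    chosen so far, and a sequence \<open>Vf\<close> of sets inside ever later members of
    \<open>V\<close>, from which the next one is taken. Step \<open>j\<close> makes \<open>F\<close>
    far from \<open>a\<close> on the chosen sets and near \<open>a\<close> on the remaining
    sequence.\<close>
  define I where "I j st \<longleftrightarrow> openin X (fst st) \<and> fst st \<noteq> {} \<and>
      (\<forall>k<j. openin Y (fst (snd st) k) \<and> fst (snd st) k \<noteq> {} \<and> (\<exists>n. fst (snd st) k \<subseteq> V n)) \<and>
      (\<forall>n. openin Y (snd (snd st) n) \<and> snd (snd st) n \<noteq> {} \<and> (\<exists>m\<ge>n. snd (snd st) n \<subseteq> V m))"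
    for j and st :: "'a set \<times> (nat \<Rightarrow> 'b set) \<times> (nat \<Rightarrow> 'b set)"
  define Q where "Q j st st' \<longleftrightarrow>
      (\<forall>k<j. fst (snd st') k \<subseteq> fst (snd st) k \<and>
         (\<forall>w\<in>fst st'. \<forall>v\<in>fst (snd st') k. \<bar>F w v - a\<bar> > t - \<eta>)) \<and>
      fst (snd st') j \<subseteq> snd (snd st') 0 \<and>
      (\<forall>n. (\<exists>m. snd (snd st') n \<subseteq> snd (snd st) m) \<and>
         (\<forall>w\<in>fst st'. \<forall>v\<in>snd (snd st') n. \<bar>F w v - a\<bar> < s + \<eta>))"
    for j and st st' :: "'a set \<times> (nat \<Rightarrow> 'b set) \<times> (nat \<Rightarrow> 'b set)"
  obtain p0 where "p0 \<in> P" using clos[of "{}" 1] by auto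
  then have base: "I 0 (topspace X, V, V)"
    unfolding I_def using P V by auto
  have step: "\<exists>st'. I (Suc j) st' \<and> Q j st st'" if Ij: "I j st" for j st
  proof -
    obtain W0 Vs Vf where st: "st = (W0, Vs, Vf)" by (cases st)
    have Vs: "openin Y (Vs k)" "Vs k \<noteq> {}" "\<exists>n. Vs k \<subseteq> V n" if "k < j" for k
      using Ij that by (auto simp: I_def st)
    have Vf: "openin Y (Vf n)" "Vf n \<noteq> {}" "\<exists>m\<ge>n. Vf n \<subseteq> V m" for n
      using Ij by (auto simp: I_def st)
    have "\<exists>z\<in>Vs k. \<bar>h z - a\<bar> \<ge> t" if "k < j" for k
      using Vs[OF that] dense by meson
    then obtain z where z: "\<And>k. k < j \<Longrightarrow> z k \<in> Vs k \<and> \<bar>h (z k) - a\<bar> \<ge> t"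
      by metis
    have zY: "z k \<in> topspace Y" if "k < j" for k
      using z Vs(1) that openin_subset by blast
    have "\<exists>p\<in>P. \<forall>y\<in>z ` {..<j}. \<bar>F p y - h y\<bar> < \<eta>"
      using zY eta by (intro clos) auto
    then obtain p where p: "p \<in> P" "\<And>k. k < j \<Longrightarrow> \<bar>F p (z k) - h (z k)\<bar> < \<eta>"
      by auto
    define T where "T = {r. \<bar>r - a\<bar> > t - \<eta>}"
    have T: "open T" unfolding T_def by (rule open_dist_real)
    define U where "U = {u \<in> topspace X. \<forall>k\<in>{..<j}. F u (z k) \<in> T}"
    have U: "openin X U"
      unfolding U_def using T cont1 zY
      by (intro openin_Collect_finite_ball openin_continuous_map_preimage) auto
    have pU: "p \<in> U"
      unfolding U_def T_def using p P z by fastforce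
    obtain y where y: "cluster_point Y Vf y"
      by (rule feebly_compactE[OF fcY Vf(1,2)])
    then have yY: "y \<in> topspace Y" by (simp add: cluster_point_def)
    obtain N where N: "\<And>n v. n \<ge> N \<Longrightarrow> v \<in> V n \<Longrightarrow> \<bar>F p v - a\<bar> \<le> s"
      using near[OF p(1)] by blast
    have "F p y \<in> {r. \<bar>r - a\<bar> \<le> s}"
    proof (rule cluster_point_closed[OF y cont2 closed_dist_real(1)])
      show "F p v \<in> {r. \<bar>r - a\<bar> \<le> s}" if nv: "n \<ge> N" "v \<in> Vf n" for n v
      proof -
        obtain m where "m \<ge> n" "Vf n \<subseteq> V m" using Vf(3) by blast
        then have "m \<ge> N" "v \<in> V m" using nv by auto
        then show ?thesis using N by simp
      qed
    qed (use p P in auto)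
    then have Fpy: "\<bar>F p y - a\<bar> \<le> s" by simp
    \<comment> \<open>It is essential that \<open>O1\<close> contains \<open>y\<close>: being a
      neighbourhood of a cluster point, it meets infinitely many \<open>Vf n\<close>, so the
      sequence can be cut down to \<open>O1\<close>.\<close>
    from strong_quasi[OF U pU yY eta(1)]
    obtain W1 O1 where W1: "openin X W1" "W1 \<noteq> {}" "W1 \<subseteq> U" and O1: "openin Y O1" "y \<in> O1"
      and nr: "\<forall>w\<in>W1. \<forall>v\<in>O1. \<bar>F w v - F p y\<bar> < \<eta>"
      by blast
    have "\<exists>W2 V2. openin X W2 \<and> W2 \<noteq> {} \<and> W2 \<subseteq> W1 \<and> (\<forall>k\<in>{..<j}. openin Y (V2 k) \<and>
        V2 k \<noteq> {} \<and> V2 k \<subseteq> Vs k \<and> (\<forall>w\<in>W2. \<forall>v\<in>V2 k. F w v \<in> T))"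
      by (rule finite_quasi[of _ _ _ _ z]) (use T W1 z Vs in \<open>auto simp: U_def\<close>)
    then obtain W2 V2 where W2: "openin X W2" "W2 \<noteq> {}" "W2 \<subseteq> W1" and
      V2: "\<forall>k\<in>{..<j}. openin Y (V2 k) \<and> V2 k \<noteq> {} \<and> V2 k \<subseteq> Vs k \<and> (\<forall>w\<in>W2. \<forall>v\<in>V2 k. F w v \<in> T)"
      by - (elim exE conjE, rule that)
    have "infinite {n. O1 \<inter> Vf n \<noteq> {}}"
      using y O1 unfolding cluster_point_def by blast
    then have "\<forall>n. \<exists>m. m \<ge> n \<and> O1 \<inter> Vf m \<noteq> {}"
      unfolding infinite_nat_iff_unbounded_le by blast
    from choice[OF this] obtain r where r: "\<And>n. r n \<ge> n" "\<And>n. O1 \<inter> Vf (r n) \<noteq> {}"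
      by blast
    define Vf' where "Vf' n = O1 \<inter> Vf (r n)" for n
    have Vf': "openin Y (Vf' n)" "Vf' n \<noteq> {}" "Vf' n \<subseteq> Vf (r n)" "Vf' n \<subseteq> O1"
      "\<exists>m\<ge>n. Vf' n \<subseteq> V m" for n
    proof -
      obtain m where "m \<ge> r n" "Vf (r n) \<subseteq> V m" using Vf(3) by blast
      then show "\<exists>m\<ge>n. Vf' n \<subseteq> V m"
        unfolding Vf'_def using r(1)[of n] by (intro exI[of _ m]) auto
    qed (use r[of n] Vf(1)[of "r n"] O1(1) in \<open>auto simp: Vf'_def\<close>)
    have nr': "\<bar>F w v - a\<bar> < s + \<eta>" if "w \<in> W2" "v \<in> O1" for w v
    proof -
      have "\<bar>F w v - F p y\<bar> < \<eta>" using that W2 nr by blast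
      then show ?thesis using Fpy by linarith
    qed
    define st' where "st' = (W2, V2(j := Vf' 0), Vf')"
    have V2V: "\<exists>n. V2 k \<subseteq> V n" if "k < j" for k
      using V2 Vs(3)[OF that] that by (meson lessThan_iff order_trans)
    have Vf'0: "\<exists>n. Vf' 0 \<subseteq> V n" using Vf'(5) by blast
    have "I (Suc j) st'"
      unfolding I_def st'_def fst_conv snd_conv
      using W2(1,2) V2 V2V Vf'(1,2,5) Vf'0 by (simp add: less_Suc_eq)
    moreover have "Q j st st'"
      unfolding Q_def st'_def st fst_conv snd_conv
      using V2 Vf'(3,4) nr' by (auto simp: T_def; blast)
    ultimately show ?thesis by blast
  qed
  obtain f where f: "\<And>n. I n (f n)" "\<And>n. Q n (f n) (f (Suc n))"
    using dependent_nat_choice[of I Q] base step by blast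
  define Ws where "Ws n = fst (f n)" for n
  define Vs where "Vs n = fst (snd (f n))" for n
  define Vf where "Vf n = snd (snd (f n))" for n
  have fI: "openin X (Ws n)" "Ws n \<noteq> {}" "k < n \<Longrightarrow> openin Y (Vs n k) \<and> Vs n k \<noteq> {}" for n k
    using f(1)[of n] by (auto simp: I_def Ws_def Vs_def)
  have fQ: "k < n \<Longrightarrow> Vs (Suc n) k \<subseteq> Vs n k"
    "k < n \<Longrightarrow> w \<in> Ws (Suc n) \<Longrightarrow> v \<in> Vs (Suc n) k \<Longrightarrow> \<bar>F w v - a\<bar> > t - \<eta>"
    "Vs (Suc n) n \<subseteq> Vf (Suc n) 0" "\<exists>m. Vf (Suc n) i \<subseteq> Vf n m"
    "w \<in> Ws (Suc n) \<Longrightarrow> v \<in> Vf (Suc n) i \<Longrightarrow> \<bar>F w v - a\<bar> < s + \<eta>" for n k w v i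
    using f(2)[of n] unfolding Q_def Ws_def Vs_def Vf_def by blast+
  have Vs: "Vs l k \<subseteq> Vs j k" if "j \<le> l" "k < j" for k j l
    using that
  proof (induction l rule: dec_induct)
    case (step l)
    then show ?case using fQ(1)[of k l] by force
  qed simp
  have Vf: "\<exists>m. Vf l i \<subseteq> Vf j m" if "j \<le> l" for i j l
    using that
  proof (induction l arbitrary: i rule: dec_induct)
    case (step l)
    then show ?case using fQ(4)[of l i] by (meson order_trans)
  qed blast
  show False
  \<comment> \<open>For \<open>j \<le> k\<close> the set \<open>V k\<close> lies in a member of the
    sequence left after step \<open>j\<close>, so \<open>F\<close> is near \<open>a\<close>. For
    \<open>k < j\<close> step \<open>j\<close> has made \<open>F\<close> far from \<open>a\<close>
    on it.\<close>
  proof (rule no_staircase[of "\<lambda>j. Ws (Suc j)" "\<lambda>k l. Vs (Suc l) k"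
        "{r. \<bar>r - a\<bar> \<le> s + \<eta>}" "{r. \<bar>r - a\<bar> \<ge> t - \<eta>}"])
    show "F w v \<in> {r. \<bar>r - a\<bar> \<le> s + \<eta>}"
      if "j \<le> k" "k \<le> l" "w \<in> Ws (Suc j)" "v \<in> Vs (Suc l) k" for j k l w v
    proof -
      have "v \<in> Vf (Suc k) 0"
        using that Vs[of "Suc k" "Suc l" k] fQ(3)[of k] by auto
      moreover have "\<exists>m. Vf (Suc k) 0 \<subseteq> Vf (Suc j) m"
        using Vf[of "Suc j" "Suc k" 0] that by auto
      then obtain m where "Vf (Suc k) 0 \<subseteq> Vf (Suc j) m" by blast
      ultimately have "v \<in> Vf (Suc j) m" by blast
      then show ?thesis using fQ(5)[OF that(3)] by fastforce
    qed
    show "F w v \<in> {r. \<bar>r - a\<bar> \<ge> t - \<eta>}"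
      if "k < j" "j < l" "w \<in> Ws (Suc j)" "v \<in> Vs (Suc l) k" for j k l w v
    proof -
      have "v \<in> Vs (Suc j) k"
        using that Vs[of "Suc j" "Suc l" k] by auto
      then show ?thesis using fQ(2)[OF that(1,3)] by fastforce
    qed
  qed (use fI eta closed_dist_real(1)[of a "s + \<eta>"] closed_dist_real(2)[of "t - \<eta>" a] in auto)
qed

text \<open>Reduces the double limit condition for points to the one for open sets. Countability of
  \<open>P\<close> allows the \<open>n\<close>-th box around a point to control the first
  \<open>n + 1\<close> functions \<open>F p\<close>. If \<open>h\<close> stays
  \<open>3 * \<epsilon>\<close> away from \<open>a\<close> on dense parts of open sets in these
  boxes, such sets replace the points. Otherwise \<open>h\<close> falls within
  \<open>3 * \<epsilon>\<close> of \<open>a\<close> arbitrarily close to some \<open>y n\<close>,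
  and the bound \<open>6 * \<epsilon>\<close> leaves a jump of at least
  \<open>3 * \<epsilon>\<close>.\<close>

lemma no_point_gap:
  fixes y :: "nat \<Rightarrow> 'b"
  assumes P: "P \<subseteq> topspace X" "countable P" and y: "\<And>n. y n \<in> topspace Y" and eps: "\<epsilon> > 0"
    and near: "\<And>p. p \<in> P \<Longrightarrow> \<exists>N. \<forall>n\<ge>N. \<bar>F p (y n) - a\<bar> \<le> \<epsilon>"
    and far: "\<And>n. \<bar>h (y n) - a\<bar> \<ge> 6 * \<epsilon>"
    and clos: "\<And>Z \<eta>. finite Z \<Longrightarrow> Z \<subseteq> topspace Y \<Longrightarrow> \<eta> > 0 \<Longrightarrow> \<exists>p\<in>P. \<forall>z\<in>Z. \<bar>F p z - h z\<bar> < \<eta>"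
  shows False
proof -
  define B where "B q k w = {v \<in> topspace Y. \<forall>i\<in>{..k}. F (q i) v \<in> {r. \<bar>r - F (q i) w\<bar> < \<epsilon>}}"
    for q :: "nat \<Rightarrow> 'a" and k :: nat and w
  have B: "openin Y (B q k w)" if "\<And>i. q i \<in> topspace X" for q k w
    unfolding B_def using cont2 that
    by (intro openin_Collect_finite_ball openin_continuous_map_preimage)
      (auto intro: open_dist_real)
  have wB: "w \<in> B q k w" if "w \<in> topspace Y" for q k w
    unfolding B_def using that eps by auto
  have Bd: "\<bar>F (q i) v - F (q i) w\<bar> < \<epsilon>" if "v \<in> B q k w" "i \<le> k" for q i k v w
    using that by (auto simp: B_def)
  have "P \<noteq> {}" using clos[of "{}" 1] by auto
  then obtain p :: "nat \<Rightarrow> 'a" where p: "range p = P"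
    using range_from_nat_into[OF _ P(2)] by blast
  then have pX: "p i \<in> topspace X" for i using P(1) by blast
  show False
  proof (cases "\<forall>n. \<exists>V'. openin Y V' \<and> V' \<noteq> {} \<and> V' \<subseteq> B p n (y n) \<and>
      (\<forall>V''. openin Y V'' \<longrightarrow> V'' \<noteq> {} \<longrightarrow> V'' \<subseteq> V' \<longrightarrow> (\<exists>z\<in>V''. \<bar>h z - a\<bar> \<ge> 3 * \<epsilon>))")
    case True
    from choice[OF this] obtain V where
      V0: "\<forall>n. openin Y (V n) \<and> V n \<noteq> {} \<and> V n \<subseteq> B p n (y n) \<and>
        (\<forall>V''. openin Y V'' \<longrightarrow> V'' \<noteq> {} \<longrightarrow> V'' \<subseteq> V n \<longrightarrow> (\<exists>z\<in>V''. \<bar>h z - a\<bar> \<ge> 3 * \<epsilon>))"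
      by (rule exE)
    then have V: "\<And>n. openin Y (V n)" "\<And>n. V n \<noteq> {}" "\<And>n. V n \<subseteq> B p n (y n)"
      "\<And>n V''. openin Y V'' \<Longrightarrow> V'' \<noteq> {} \<Longrightarrow> V'' \<subseteq> V n \<Longrightarrow> \<exists>z\<in>V''. \<bar>h z - a\<bar> \<ge> 3 * \<epsilon>"
      by simp_all
    show False
    proof (rule no_open_gap[OF P(1) V(1,2) _ _ clos V(4)])
      fix q assume "q \<in> P"
      then obtain i where i: "q = p i" using p by blast
      obtain N where N: "\<And>n. n \<ge> N \<Longrightarrow> \<bar>F q (y n) - a\<bar> \<le> \<epsilon>" using near \<open>q \<in> P\<close> by blast
      have "\<bar>F q v - a\<bar> \<le> 2 * \<epsilon>" if "n \<ge> max N i" "v \<in> V n" for n v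
      proof -
        have "\<bar>F q v - F q (y n)\<bar> < \<epsilon>"
          using Bd[of v p n "y n" i] V(3)[of n] that by (auto simp: i)
        then show ?thesis using N[of n] that by auto
      qed
      then show "\<exists>N. \<forall>n\<ge>N. \<forall>v\<in>V n. \<bar>F q v - a\<bar> \<le> 2 * \<epsilon>" by blast
    qed (use eps in auto)
  next
    case False \<comment> \<open>\<open>h\<close> jumps at \<open>y n\<close>: sets near \<open>y n\<close> now play the role of the sequence, with \<open>h (y n)\<close> for \<open>a\<close>\<close>
    then obtain n where "\<not> (\<exists>V'. openin Y V' \<and> V' \<noteq> {} \<and> V' \<subseteq> B p n (y n) \<and>
      (\<forall>V''. openin Y V'' \<longrightarrow> V'' \<noteq> {} \<longrightarrow> V'' \<subseteq> V' \<longrightarrow> (\<exists>z\<in>V''. \<bar>h z - a\<bar> \<ge> 3 * \<epsilon>)))"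
      unfolding not_all by (rule exE)
    then have n: "\<exists>V''. openin Y V'' \<and> V'' \<noteq> {} \<and> V'' \<subseteq> V' \<and> (\<forall>z\<in>V''. \<bar>h z - a\<bar> < 3 * \<epsilon>)"
      if "openin Y V'" "V' \<noteq> {}" "V' \<subseteq> B p n (y n)" for V'
      using that by (meson not_less)
    define b where "b = h (y n)"
    \<comment> \<open>Only functions with values near \<open>b\<close> at \<open>y n\<close> are
      kept. They still approximate \<open>h\<close> on finite sets, since \<open>y n\<close> can be
      added to any such set.\<close>
    define P' where "P' = {q \<in> P. \<bar>F q (y n) - b\<bar> < \<epsilon>}"
    have clos': "\<exists>q\<in>P'. \<forall>z\<in>Z. \<bar>F q z - h z\<bar> < \<eta>" if "finite Z" "Z \<subseteq> topspace Y" "\<eta> > 0" for Z \<eta>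
    proof -
      have "\<exists>q\<in>P. \<forall>z\<in>insert (y n) Z. \<bar>F q z - h z\<bar> < min \<eta> \<epsilon>"
        using that y eps by (intro clos) auto
      then show ?thesis by (auto simp: P'_def b_def)
    qed
    have "P' \<noteq> {}" "countable P'"
      using clos'[of "{}" 1] P(2) by (auto simp: P'_def)
    from range_from_nat_into[OF this] obtain p' :: "nat \<Rightarrow> 'a" where p': "range p' = P'"
      by blast
    then have p'X: "p' i \<in> topspace X" for i using P(1) by (auto simp: P'_def)
    have "\<exists>V''. openin Y V'' \<and> V'' \<noteq> {} \<and> V'' \<subseteq> B p n (y n) \<inter> B p' k (y n) \<and>
        (\<forall>z\<in>V''. \<bar>h z - a\<bar> < 3 * \<epsilon>)" for k
      using wB[OF y, of n p n] wB[OF y, of n p' k] by (intro n openin_Int B pX p'X) auto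
    then have "\<forall>k. \<exists>V''. openin Y V'' \<and> V'' \<noteq> {} \<and> V'' \<subseteq> B p n (y n) \<inter> B p' k (y n) \<and>
        (\<forall>z\<in>V''. \<bar>h z - a\<bar> < 3 * \<epsilon>)" by blast
    from choice[OF this] obtain V where
      "\<forall>k. openin Y (V k) \<and> V k \<noteq> {} \<and> V k \<subseteq> B p n (y n) \<inter> B p' k (y n) \<and>
        (\<forall>z\<in>V k. \<bar>h z - a\<bar> < 3 * \<epsilon>)"
      by (rule exE)
    then have V: "\<And>k. openin Y (V k)" "\<And>k. V k \<noteq> {}"
      "\<And>k. V k \<subseteq> B p' k (y n)" "\<And>k z. z \<in> V k \<Longrightarrow> \<bar>h z - a\<bar> < 3 * \<epsilon>"
      by simp_all
    show False
    proof (rule no_open_gap[of P' V "2 * \<epsilon>" "3 * \<epsilon>" b h])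
      fix q assume q: "q \<in> P'"
      then obtain i where i: "q = p' i" using p' by blast
      have "\<bar>F q v - b\<bar> \<le> 2 * \<epsilon>" if "k \<ge> i" "v \<in> V k" for k v
      proof -
        have "\<bar>F q v - F q (y n)\<bar> < \<epsilon>"
          using Bd[of v p' k "y n" i] V(3)[of k] that by (auto simp: i)
        then show ?thesis using q by (auto simp: P'_def)
      qed
      then show "\<exists>N. \<forall>n\<ge>N. \<forall>v\<in>V n. \<bar>F q v - b\<bar> \<le> 2 * \<epsilon>" by blast
    next
      fix k V' assume "V' \<noteq> {}" "V' \<subseteq> V k"
      then obtain z where "z \<in> V'" "z \<in> V k" by blast
      moreover have "\<bar>h z - b\<bar> \<ge> 3 * \<epsilon>"
        using V(4)[OF \<open>z \<in> V k\<close>] far[of n] unfolding b_def by linarith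
      ultimately show "\<exists>z\<in>V'. \<bar>h z - b\<bar> \<ge> 3 * \<epsilon>" by blast
    qed (use P V clos' eps in \<open>auto simp: P'_def\<close>)
  qed
qed

section \<open>Fragmentation by Christensen's argument\<close>

text \<open>If every nonempty relatively open set had larger oscillation, a recursion would give
  points with \<open>F (xs i) (ys n)\<close> and \<open>F (xs i) (zs n)\<close> asymptotically equal
  for \<open>n > i\<close> but more than \<open>\<delta>\<close> apart for \<open>n \<le> i\<close>.
  This violates the double limit condition.\<close>

lemma fragmented:
  assumes A: "A \<subseteq> topspace X" "A \<noteq> {}" and B: "B \<subseteq> topspace Y" and eps: "\<epsilon> > 0"
    and bound: "\<And>x y. x \<in> topspace X \<Longrightarrow> y \<in> topspace Y \<Longrightarrow> \<bar>F x y\<bar> \<le> M"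
  shows "\<exists>U. openin (subtopology X A) U \<and> U \<noteq> {} \<and> (\<forall>u\<in>U. \<forall>v\<in>U. \<forall>y\<in>B. \<bar>F u y - F v y\<bar> \<le> \<epsilon>)"
proof (rule ccontr)
  assume contra: "\<not> ?thesis"
  define \<delta> where "\<delta> = \<epsilon> / 3"
  have delta: "\<delta> > 0" using eps by (simp add: \<delta>_def)
  have openA: "openin (subtopology X A) (U \<inter> D)" if "openin (subtopology X A) U" "openin X D" for U D
  proof -
    obtain T where "openin X T" "U = T \<inter> A"
      using \<open>openin (subtopology X A) U\<close> unfolding openin_subtopology by blast
    then show ?thesis
      using \<open>openin X D\<close> unfolding openin_subtopology by (intro exI[of _ "T \<inter> D"]) auto
  qed
  \<comment> \<open>Otherwise \<open>F x y\<close> is determined up to \<open>\<delta>\<close> by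
    the grid cells of the values \<open>F k y\<close> with \<open>k \<in> K\<close>. Boundedness
    leaves finitely many patterns of cells, hence finitely many representatives \<open>y'\<close>.
    Continuity at these gives a set of oscillation at most
    \<open>3 * \<delta> = \<epsilon>\<close>.\<close>
  have pair: "\<exists>y\<in>B. \<exists>y'\<in>B. \<exists>x\<in>U. (\<forall>k\<in>K. \<bar>F k y - F k y'\<bar> < \<eta>) \<and> \<bar>F x y - F x y'\<bar> > \<delta>"
    if U: "openin (subtopology X A) U" "U \<noteq> {}" and K: "finite K" "K \<subseteq> topspace X" and eta: "\<eta> > 0"
    for U K \<eta>
  proof (rule ccontr)
    assume no: "\<not> ?thesis"
    define \<phi> where "\<phi> y = (\<lambda>k\<in>K. \<lfloor>F k y / \<eta>\<rfloor>)" for y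
    have same: "\<bar>F x y - F x y'\<bar> \<le> \<delta>" if "y \<in> B" "y' \<in> B" "\<phi> y = \<phi> y'" "x \<in> U" for x y y'
    proof -
      have "\<bar>F k y - F k y'\<bar> < \<eta>" if "k \<in> K" for k
      proof -
        have "\<lfloor>F k y / \<eta>\<rfloor> = \<lfloor>F k y' / \<eta>\<rfloor>"
          using fun_cong[OF \<open>\<phi> y = \<phi> y'\<close>, of k] that by (simp add: \<phi>_def)
        then have "\<bar>F k y / \<eta> - F k y' / \<eta>\<bar> < 1" by linarith
        then have "\<bar>(F k y - F k y') / \<eta>\<bar> < 1" by (simp add: diff_divide_distrib)
        then show ?thesis using eta by (simp add: abs_divide)
      qed
      then show ?thesis using no that by (meson not_less)
    qed
    have "\<phi> ` B \<subseteq> K \<rightarrow>\<^sub>E {\<lfloor>- M / \<eta>\<rfloor>..\<lfloor>M / \<eta>\<rfloor>}"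
    proof (intro image_subsetI PiE_I)
      fix y k assume "y \<in> B" "k \<in> K"
      then have "\<bar>F k y\<bar> \<le> M" using bound K B by blast
      then have "- M / \<eta> \<le> F k y / \<eta>" "F k y / \<eta> \<le> M / \<eta>"
        using eta by (intro divide_right_mono; simp)+
      then show "\<phi> y k \<in> {\<lfloor>- M / \<eta>\<rfloor>..\<lfloor>M / \<eta>\<rfloor>}"
        using \<open>k \<in> K\<close> by (simp add: \<phi>_def floor_mono)
    qed (simp add: \<phi>_def)
    then have "finite (\<phi> ` B)" by (rule finite_subset) (simp add: K(1) finite_PiE)
    then obtain R where R: "R \<subseteq> B" "finite R" "\<phi> ` B = \<phi> ` R"
      by (meson finite_subset_image order_refl)
    obtain u0 where u0: "u0 \<in> U" using U by blast
    define D where "D = {x \<in> topspace X. \<forall>y\<in>R. F x y \<in> {r. \<bar>r - F u0 y\<bar> < \<delta> / 2}}"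
    have "openin X D"
      unfolding D_def using R B cont1 open_dist_real(1)[of _ "\<delta> / 2"]
      by (intro openin_Collect_finite_ball openin_continuous_map_preimage) auto
    then have "openin (subtopology X A) (U \<inter> D)" using U by (intro openA)
    moreover have "u0 \<in> U \<inter> D"
      using u0 delta openin_subset[OF U(1)] by (auto simp: D_def)
    moreover have "\<bar>F u y - F v y\<bar> \<le> \<epsilon>" if "u \<in> U \<inter> D" "v \<in> U \<inter> D" "y \<in> B" for u v y
    proof -
      obtain y' where y': "y' \<in> R" "\<phi> y = \<phi> y'" using R \<open>y \<in> B\<close> by blast
      then have "\<bar>F u y - F u y'\<bar> \<le> \<delta>" "\<bar>F v y - F v y'\<bar> \<le> \<delta>"
        using same[of y y'] that R by auto
      moreover have "\<bar>F u y' - F u0 y'\<bar> < \<delta> / 2" "\<bar>F v y' - F u0 y'\<bar> < \<delta> / 2"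
        using that y' by (auto simp: D_def)
      ultimately show ?thesis unfolding \<delta>_def by linarith
    qed
    ultimately show False using contra by blast
  qed
  \<comment> \<open>\<open>U\<close> is the current relatively open set and \<open>K\<close>
    collects the points \<open>x\<close> chosen so far. The new pair \<open>y\<close>,
    \<open>y'\<close> is nearly indistinguishable on the old \<open>K\<close> but separated on the
    whole new \<open>U\<close>.\<close>
  define I where "I s \<longleftrightarrow> openin (subtopology X A) (fst s) \<and> fst s \<noteq> {} \<and>
      finite (fst (snd s)) \<and> fst (snd s) \<subseteq> topspace X"
    for s :: "'a set \<times> 'a set \<times> 'a \<times> 'b \<times> 'b"
  define Q where "Q n s s' \<longleftrightarrow> (case s' of (U, K, x, y, y') \<Rightarrow> U \<subseteq> fst s \<and> K = insert x (fst (snd s)) \<and>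
      x \<in> U \<and> y \<in> B \<and> y' \<in> B \<and> (\<forall>k\<in>fst (snd s). \<bar>F k y - F k y'\<bar> < inverse (real (Suc n))) \<and>
      (\<forall>u\<in>U. \<bar>F u y - F u y'\<bar> > \<delta>))"
    for n :: nat and s s' :: "'a set \<times> 'a set \<times> 'a \<times> 'b \<times> 'b"
  \<comment> \<open>\<open>Q\<close> reads only the first two components of the earlier state, so
    the starting points can be arbitrary. The sequences below are read off from stage
    \<open>Suc n\<close>.\<close>
  have base: "I (A, {}, undefined)"
    using A by (auto simp: I_def openin_subtopology_refl)
  have step: "\<exists>s'. I s' \<and> Q n s s'" if "I s" for n s
  proof -
    obtain U K z where s: "s = (U, K, z)" by (cases s)
    have U: "openin (subtopology X A) U" "U \<noteq> {}" "finite K" "K \<subseteq> topspace X"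
      using that by (auto simp: I_def s)
    from pair[OF this, of "inverse (real (Suc n))"]
    obtain y y' x where yx: "y \<in> B" "y' \<in> B" "x \<in> U" "\<bar>F x y - F x y'\<bar> > \<delta>"
      "\<forall>k\<in>K. \<bar>F k y - F k y'\<bar> < inverse (real (Suc n))"
      by auto
    define D where "D = {u \<in> topspace X. F u y - F u y' \<in> {r. \<bar>r - 0\<bar> > \<delta>}}"
    have "openin X D"
      unfolding D_def using cont1 yx B open_dist_real(2)[of \<delta> 0]
      by (intro openin_continuous_map_preimage[where Y = euclideanreal] continuous_map_diff) auto
    then have UD: "openin (subtopology X A) (U \<inter> D)" using U by (intro openA)
    have xU: "x \<in> U \<inter> D" "x \<in> topspace X"
      using yx openin_subset[OF U(1)] by (auto simp: D_def)
    have "I (U \<inter> D, insert x K, x, y, y')"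
      using UD xU U by (auto simp: I_def)
    moreover have "Q n s (U \<inter> D, insert x K, x, y, y')"
      using xU yx by (auto simp: Q_def s D_def)
    ultimately show ?thesis by blast
  qed
  obtain f where f: "\<And>n. I (f n)" "\<And>n. Q n (f n) (f (Suc n))"
    using dependent_nat_choice[of "\<lambda>_. I" Q] base step by blast
  define U where "U n = fst (f n)" for n
  define K where "K n = fst (snd (f n))" for n
  define xs where "xs n = fst (snd (snd (f (Suc n))))" for n
  define ys where "ys n = fst (snd (snd (snd (f (Suc n)))))" for n
  define zs where "zs n = snd (snd (snd (snd (f (Suc n)))))" for n
  have fI: "U n \<subseteq> A" "K n \<subseteq> topspace X" for n
    using f(1)[of n] openin_subset[of "subtopology X A" "U n"] by (auto simp: I_def U_def K_def)
  have fQ: "U (Suc n) \<subseteq> U n" "K (Suc n) = insert (xs n) (K n)" "xs n \<in> U (Suc n)" "ys n \<in> B" "zs n \<in> B"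
    "k \<in> K n \<Longrightarrow> \<bar>F k (ys n) - F k (zs n)\<bar> < inverse (real (Suc n))"
    "u \<in> U (Suc n) \<Longrightarrow> \<bar>F u (ys n) - F u (zs n)\<bar> > \<delta>" for n k u
    using f(2)[of n] by (auto simp: Q_def U_def K_def xs_def ys_def zs_def split: prod.splits)
  have U: "U l \<subseteq> U j" if "j \<le> l" for j l
    using lift_Suc_antimono_le[of U] fQ(1) that by blast
  have K: "K j \<subseteq> K l" if "j \<le> l" for j l
    using lift_Suc_mono_le[of K] fQ(2) that by blast
  have xsX: "xs i \<in> topspace X" for i
    using fQ(3) fI(1) A(1) by blast
  have ysY: "ys i \<in> topspace Y" "zs i \<in> topspace Y" for i
    using fQ(4,5) B by blast+
  have close: "\<bar>F (xs i) (ys n) - F (xs i) (zs n)\<bar> < inverse (real (Suc n))" if "i < n" for i n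
    using fQ(2)[of i] K[of "Suc i" n] that by (intro fQ(6)) auto
  have apart: "\<bar>F (xs i) (ys n) - F (xs i) (zs n)\<bar> > \<delta>" if "n \<le> i" for i n
    using fQ(3)[of i] U[of "Suc n" "Suc i"] that by (intro fQ(7)) auto
  obtain g where g: "\<And>Z \<eta> N. finite Z \<Longrightarrow> \<eta> > 0 \<Longrightarrow> \<exists>n\<ge>N. \<forall>i\<in>Z. \<bar>F (xs i) (ys n) - g i\<bar> < \<eta>"
    by (rule pointwise_cluster[of "\<lambda>n i. F (xs i) (ys n)" M]) (use bound xsX ysY in auto)
  have "\<bar>g i\<bar> \<le> M + 1" for i
  proof -
    obtain n where "\<bar>F (xs i) (ys n) - g i\<bar> < 1" using g[of "{i}" 1 0] by auto
    moreover have "\<bar>F (xs i) (ys n)\<bar> \<le> M" using bound xsX ysY by blast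
    ultimately show ?thesis by linarith
  qed
  moreover have "M \<ge> 0" using bound[OF xsX[of 0] ysY(1)[of 0]] by linarith
  moreover have "\<bar>F (xs i) y\<bar> \<le> M + 1" if "y \<in> topspace Y" for i y
    using bound[OF xsX that, of i] by linarith
  \<comment> \<open>The extra index \<open>None\<close> carries \<open>g\<close>, so that a single
    \<open>i\<close> makes \<open>g i\<close> close to \<open>a\<close> and \<open>F (xs i)\<close>
    close to \<open>h\<close> on a finite set. The value 0 outside \<open>topspace Y\<close> keeps
    the family bounded everywhere.\<close>
  ultimately have "\<bar>case z of None \<Rightarrow> g i | Some y \<Rightarrow> if y \<in> topspace Y then F (xs i) y else 0\<bar> \<le> M + 1"
    for i z by (simp split: option.split)
  then obtain H where H: "\<And>Z \<eta> N. finite Z \<Longrightarrow> \<eta> > 0 \<Longrightarrow> \<exists>i\<ge>N. \<forall>z\<in>Z.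
      \<bar>(case z of None \<Rightarrow> g i | Some y \<Rightarrow> if y \<in> topspace Y then F (xs i) y else 0) - H z\<bar> < \<eta>"
    by (rule pointwise_cluster[of "\<lambda>i z. case z of None \<Rightarrow> g i | Some y \<Rightarrow>
          if y \<in> topspace Y then F (xs i) y else 0" "M + 1"]) (erule that)
  define a where "a = H None"
  define h where "h y = H (Some y)" for y
  have Hh: "\<exists>i\<ge>N. \<bar>g i - a\<bar> < \<eta> \<and> (\<forall>z\<in>Z. \<bar>F (xs i) z - h z\<bar> < \<eta>)"
    if Z: "finite Z" "Z \<subseteq> topspace Y" and eta: "\<eta> > 0" for Z \<eta> N
  proof -
    have "finite (insert None (Some ` Z))" using Z by simp
    from H[OF this eta, of N] show ?thesis
      using Z(2) by (auto simp: a_def h_def subset_iff)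
  qed
  \<comment> \<open>For large \<open>i\<close> the values at \<open>ys n\<close> and
    \<open>zs n\<close> differ by more than \<open>\<delta>\<close>, so those of \<open>h\<close>
    differ by more than \<open>\<delta> / 2\<close>, and one of them is at least
    \<open>\<delta> / 4 = 6 * \<epsilon>'\<close> away from \<open>a\<close>.\<close>
  define \<epsilon>' where "\<epsilon>' = \<delta> / 24"
  have eps': "\<epsilon>' > 0" using delta by (simp add: \<epsilon>'_def)
  have hfar: "\<bar>h (ys n) - a\<bar> \<ge> 6 * \<epsilon>' \<or> \<bar>h (zs n) - a\<bar> \<ge> 6 * \<epsilon>'" for n
  proof -
    obtain i where "i \<ge> n" "\<bar>F (xs i) (ys n) - h (ys n)\<bar> < \<delta> / 4" "\<bar>F (xs i) (zs n) - h (zs n)\<bar> < \<delta> / 4"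
      using Hh[of "{ys n, zs n}" "\<delta> / 4" n] ysY delta by auto
    then show ?thesis using apart[of n i] unfolding \<epsilon>'_def by linarith
  qed
  \<comment> \<open>A diagonal choice turns the cluster function \<open>g\<close> into a genuine
    limit of \<open>F (xs i) (ys (m k))\<close> for every \<open>i\<close>. The same limit holds
    with \<open>zs\<close>, so \<open>w\<close> may take whichever point is far for
    \<open>h\<close>.\<close>
  have "\<forall>k. \<exists>n. n \<ge> k \<and> (\<forall>i\<in>{..k}. \<bar>F (xs i) (ys n) - g i\<bar> < inverse (real (Suc k)))"
    by (intro allI g) auto
  from choice[OF this] obtain m where
    "\<forall>k. m k \<ge> k \<and> (\<forall>i\<in>{..k}. \<bar>F (xs i) (ys (m k)) - g i\<bar> < inverse (real (Suc k)))"
    by (rule exE)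
  then have m: "m k \<ge> k" "i \<le> k \<Longrightarrow> \<bar>F (xs i) (ys (m k)) - g i\<bar> < inverse (real (Suc k))" for i k
    by simp_all
  define w where "w k = (if \<bar>h (ys (m k)) - a\<bar> \<ge> 6 * \<epsilon>' then ys (m k) else zs (m k))" for k
  show False
  proof (rule no_point_gap[of "xs ` {i. \<bar>g i - a\<bar> < \<epsilon>' / 2}" w \<epsilon>' a h])
    show "6 * \<epsilon>' \<le> \<bar>h (w n) - a\<bar>" for n
      using hfar[of "m n"] by (auto simp: w_def)
    fix p assume "p \<in> xs ` {i. \<bar>g i - a\<bar> < \<epsilon>' / 2}"
    then obtain i where i: "p = xs i" "\<bar>g i - a\<bar> < \<epsilon>' / 2" by blast
    obtain N where N: "inverse (real (Suc N)) < \<epsilon>' / 4"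
      using reals_Archimedean[of "\<epsilon>' / 4"] eps' by auto
    have "\<bar>F p (w k) - a\<bar> \<le> \<epsilon>'" if k: "k \<ge> max N (Suc i)" for k
    proof -
      have inv: "inverse (real (Suc k)) \<le> inverse (real (Suc N))"
        "inverse (real (Suc (m k))) \<le> inverse (real (Suc N))"
        using k m(1)[of k] by (intro le_imp_inverse_le; simp)+
      have "\<bar>F p (ys (m k)) - g i\<bar> < inverse (real (Suc k))"
        using m(2)[of i k] k i by simp
      moreover have "\<bar>F p (ys (m k)) - F p (zs (m k))\<bar> < inverse (real (Suc (m k)))"
        using close[of i "m k"] m(1)[of k] k i by simp
      ultimately have "\<bar>F p (ys (m k)) - a\<bar> \<le> \<epsilon>'" "\<bar>F p (zs (m k)) - a\<bar> \<le> \<epsilon>'"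
        using inv N i(2) by linarith+
      then show ?thesis by (simp add: w_def)
    qed
    then show "\<exists>N. \<forall>n\<ge>N. \<bar>F p (w n) - a\<bar> \<le> \<epsilon>'" by blast
  next
    fix Z :: "'b set" and \<eta> :: real
    assume Z: "finite Z" "Z \<subseteq> topspace Y" "\<eta> > 0"
    obtain i where "\<bar>g i - a\<bar> < min \<eta> (\<epsilon>' / 2)" "\<forall>z\<in>Z. \<bar>F (xs i) z - h z\<bar> < min \<eta> (\<epsilon>' / 2)"
      using Hh[OF Z(1,2), of "min \<eta> (\<epsilon>' / 2)" 0] Z(3) eps' by auto
    then show "\<exists>p\<in>xs ` {i. \<bar>g i - a\<bar> < \<epsilon>' / 2}. \<forall>z\<in>Z. \<bar>F p z - h z\<bar> < \<eta>" by auto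
  qed (use xsX ysY eps' in \<open>auto simp: w_def\<close>)
qed

end

section \<open>The monoid multiplication and its subgroup\<close>

text \<open>Separate continuity comes from composing \<open>f\<close> with translations. For
  quasicontinuity, the nonempty open set in the product supplied by the hypothesis contains a
  nonempty open box.\<close>

lemma quasi_sepI:
  assumes X: "pseudocompact_space X" "tychonoff_space X" and S: "semitopological_monoid X S"
    and qc: "quasicontinuous_map (prod_topology X X) X (\<lambda>(x, y). x \<otimes>\<^bsub>S\<^esub> y)"
    and f: "continuous_map X euclideanreal f"
  shows "quasi_sep X X (\<lambda>x y. f (x \<otimes>\<^bsub>S\<^esub> y))"
proof
  show "feebly_compact_space X"
    using X pseudocompact_imp_feebly_compact unfolding tychonoff_space_def by blast
  show "continuous_map X euclideanreal (\<lambda>x. f (x \<otimes>\<^bsub>S\<^esub> y))" if "y \<in> topspace X" for y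
    using S that continuous_map_compose[OF _ f, of X "\<lambda>x. x \<otimes>\<^bsub>S\<^esub> y"]
    by (simp add: semitopological_monoid_def o_def)
  show "continuous_map X euclideanreal (\<lambda>y. f (x \<otimes>\<^bsub>S\<^esub> y))" if "x \<in> topspace X" for x
    using S that continuous_map_compose[OF _ f, of X "\<lambda>y. x \<otimes>\<^bsub>S\<^esub> y"]
    by (simp add: semitopological_monoid_def o_def)
  fix x y U V T
  assume U: "openin X U" "x \<in> U" and V: "openin X V" "y \<in> V" and T: "open T" "f (x \<otimes>\<^bsub>S\<^esub> y) \<in> T"
  define E where "E = {z \<in> topspace X. f z \<in> T}"
  have xy: "(x, y) \<in> topspace (prod_topology X X)"
    using U V openin_subset[OF U(1)] openin_subset[OF V(1)] by auto
  have "(\<lambda>(x, y). x \<otimes>\<^bsub>S\<^esub> y) \<in> topspace (prod_topology X X) \<rightarrow> topspace X"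
    using qc unfolding quasicontinuous_map_def by (rule conjunct1)
  from funcset_mem[OF this xy] have "x \<otimes>\<^bsub>S\<^esub> y \<in> topspace X" by simp
  then have E: "openin X E" "(case (x, y) of (x, y) \<Rightarrow> x \<otimes>\<^bsub>S\<^esub> y) \<in> E"
    unfolding E_def using T f by (auto intro!: openin_continuous_map_preimage)
  have UV: "openin (prod_topology X X) (U \<times> V)" "(x, y) \<in> U \<times> V"
    using U V by (auto simp: openin_prod_Times_iff)
  from qc[unfolded quasicontinuous_map_def, THEN conjunct2, THEN bspec, OF xy] E UV
  obtain D where D: "openin (prod_topology X X) D" "D \<noteq> {}" "D \<subseteq> U \<times> V"
    "(\<lambda>(x, y). x \<otimes>\<^bsub>S\<^esub> y) ` D \<subseteq> E"
    by blast
  then obtain p q where pq: "(p, q) \<in> D" by auto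
  from D(1)[unfolded openin_prod_topology_alt, rule_format, OF pq]
  obtain W V' where W: "openin X W" "openin X V'" "p \<in> W" "q \<in> V'" "W \<times> V' \<subseteq> D"
    by (elim exE conjE) (rule that)
  have "f (w \<otimes>\<^bsub>S\<^esub> v) \<in> T" if "w \<in> W" "v \<in> V'" for w v
    using that W(5) D(4) by (fastforce simp: E_def)
  moreover have "W \<subseteq> U" "V' \<subseteq> V" using W D(3) by blast+
  ultimately show "\<exists>W V'. openin X W \<and> W \<noteq> {} \<and> W \<subseteq> U \<and> openin X V' \<and> V' \<noteq> {} \<and> V' \<subseteq> V \<and>
      (\<forall>w\<in>W. \<forall>v\<in>V'. f (w \<otimes>\<^bsub>S\<^esub> v) \<in> T)"
    using W by (intro exI[of _ W] exI[of _ V']) auto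
qed

text \<open>Real functions detect neighbourhoods, so continuity into the subgroup can be checked
  through the estimates for \<open>f\<close>.\<close>

lemma completely_regular_nbhd:
  assumes "completely_regular_space X" "openin X V" "x \<in> V"
  shows "\<exists>f. continuous_map X euclideanreal f \<and> f x = 0 \<and> (\<forall>z\<in>topspace X. \<bar>f z\<bar> < 1 \<longrightarrow> z \<in> V)"
proof -
  have "closedin X (topspace X - V)" "x \<in> topspace X - (topspace X - V)"
    using assms openin_subset by auto
  with assms(1) obtain f :: "'a \<Rightarrow> real" where
    f: "continuous_map X (top_of_set {0..1}) f" "f x = 0" "f ` (topspace X - V) \<subseteq> {1}"
    unfolding completely_regular_space_def by blast
  show ?thesis
  proof (intro exI[of _ f] conjI ballI impI)
    show "continuous_map X euclideanreal f" "f x = 0"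
      using f by (auto simp: continuous_map_in_subtopology)
    show "z \<in> V" if "z \<in> topspace X" "\<bar>f z\<bar> < 1" for z
      using f(3) that by (cases "z \<in> V") auto
  qed
qed

theorem corollary5p2:
  fixes X :: "'a topology" and S :: "('a, 'b) monoid_scheme" and G :: "'a set" and e :: 'a
  assumes "semitopological_monoid X S"
    and "pseudocompact_space X"
    and "tychonoff_space X"
    and "quasicontinuous_map (prod_topology X X) X (\<lambda>(x, y). x \<otimes>\<^bsub>S\<^esub> y)"
    and "semigroup_subgroup G e S"
  shows "topological_group (subtopology X G) (restrict_monoid S G e)"
proof -
  define R where "R = restrict_monoid S G e"
  define T where "T = subtopology X G"
  have R: "carrier R = G" "mult R = mult S" "one R = e"
    by (simp_all add: R_def restrict_monoid_def)
  have GX: "G \<subseteq> topspace X" and grp: "group R"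
    using assms(1,5) by (auto simp: semigroup_subgroup_def semitopological_monoid_def R_def)
  interpret R: group R by (rule grp)
  note mG = R.m_closed[unfolded R(1)] and iG = R.inv_closed[unfolded R(1)]
  have cr: "completely_regular_space X"
    using assms(3) by (simp add: tychonoff_space_def)
  have topT: "topspace T = G" unfolding T_def using GX by auto
  have lcont: "continuous_map T T (\<lambda>x. a \<otimes>\<^bsub>R\<^esub> x)" and rcont: "continuous_map T T (\<lambda>x. x \<otimes>\<^bsub>R\<^esub> a)"
    if "a \<in> G" for a
  proof -
    have "continuous_map X X (\<lambda>x. a \<otimes>\<^bsub>R\<^esub> x)" "continuous_map X X (\<lambda>x. x \<otimes>\<^bsub>R\<^esub> a)"
      using assms(1) GX that by (auto simp: semitopological_monoid_def R)
    moreover have "a \<otimes>\<^bsub>R\<^esub> x \<in> G" "x \<otimes>\<^bsub>R\<^esub> a \<in> G" if "x \<in> G" for x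
      using \<open>a \<in> G\<close> that by (simp_all add: mG)
    ultimately show "continuous_map T T (\<lambda>x. a \<otimes>\<^bsub>R\<^esub> x)" "continuous_map T T (\<lambda>x. x \<otimes>\<^bsub>R\<^esub> a)"
      unfolding T_def by (auto simp: continuous_map_in_subtopology intro: continuous_map_from_subtopology)
  qed
  have equi: "\<exists>N. openin T N \<and> e \<in> N \<and> (\<forall>u\<in>N. \<forall>y\<in>G. \<bar>f (u \<otimes>\<^bsub>R\<^esub> y) - f y\<bar> \<le> \<epsilon>)"
    if f: "continuous_map X euclideanreal f" and eps: "\<epsilon> > 0" for f \<epsilon>
  proof -
    interpret quasi_sep X X "\<lambda>x y. f (x \<otimes>\<^bsub>S\<^esub> y)"
      by (rule quasi_sepI) (use assms f in auto)
    obtain M where M: "\<And>z. z \<in> topspace X \<Longrightarrow> \<bar>f z\<bar> \<le> M"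
      using assms(2) f unfolding pseudocompact_space_def bounded_iff by fastforce
    have "\<bar>f (x \<otimes>\<^bsub>S\<^esub> y)\<bar> \<le> M" if "x \<in> topspace X" "y \<in> topspace X" for x y
    proof (rule M)
      show "x \<otimes>\<^bsub>S\<^esub> y \<in> topspace X"
        using assms(1) that monoid.m_closed[of S x y] by (simp add: semitopological_monoid_def)
    qed
    moreover have "G \<noteq> {}" using R.one_closed R(1) by blast
    ultimately obtain U where U: "openin T U" "U \<noteq> {}"
      "\<And>u v y. u \<in> U \<Longrightarrow> v \<in> U \<Longrightarrow> y \<in> G \<Longrightarrow> \<bar>f (u \<otimes>\<^bsub>R\<^esub> y) - f (v \<otimes>\<^bsub>R\<^esub> y)\<bar> \<le> \<epsilon>"
      using fragmented[OF GX _ GX eps, of M] unfolding T_def R(2) by meson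
    obtain g where g: "g \<in> U" using U(2) by blast
    then have gG: "g \<in> G" using openin_subset[OF U(1)] topT by blast
    \<comment> \<open>This is the right translate of \<open>U\<close> by the inverse of
      \<open>g\<close>. With \<open>z\<close> the product of that inverse and \<open>y\<close>, the
      elements \<open>uy\<close> and \<open>y\<close> become \<open>(ug)z\<close> and
      \<open>gz\<close>, where \<open>ug\<close> and \<open>g\<close> lie in \<open>U\<close> and
      \<open>z\<close> lies in \<open>G\<close>.\<close>
    define N where "N = {u \<in> topspace T. u \<otimes>\<^bsub>R\<^esub> g \<in> U}"
    have "openin T N"
      unfolding N_def using rcont[OF gG] U(1) by (rule openin_continuous_map_preimage)
    moreover have "e \<in> N"
      unfolding N_def topT using R.l_one[unfolded R(1,3), OF gG] R.one_closed[unfolded R(1,3)] g by simp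
    moreover have "\<bar>f (u \<otimes>\<^bsub>R\<^esub> y) - f y\<bar> \<le> \<epsilon>" if "u \<in> N" "y \<in> G" for u y
    proof -
      have u: "u \<in> carrier R" "u \<otimes>\<^bsub>R\<^esub> g \<in> U" and c: "g \<in> carrier R" "y \<in> carrier R"
        using that gG by (auto simp: N_def topT R(1))
      have "u \<otimes>\<^bsub>R\<^esub> g \<otimes>\<^bsub>R\<^esub> (inv\<^bsub>R\<^esub> g \<otimes>\<^bsub>R\<^esub> y) = u \<otimes>\<^bsub>R\<^esub> y"
        using u c by (simp add: R.m_assoc R.inv_solve_left' flip: R.m_assoc[of g])
      moreover have "g \<otimes>\<^bsub>R\<^esub> (inv\<^bsub>R\<^esub> g \<otimes>\<^bsub>R\<^esub> y) = y"
        using c by (simp flip: R.m_assoc)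
      moreover have "inv\<^bsub>R\<^esub> g \<otimes>\<^bsub>R\<^esub> y \<in> G"
        using that gG by (intro mG iG)
      ultimately show ?thesis using U(3)[OF u(2) g] by metis
    qed
    ultimately show ?thesis by blast
  qed
  have nbhd: "\<exists>f. continuous_map X euclideanreal f \<and> f x = 0 \<and> (\<forall>z\<in>G. \<bar>f z\<bar> < 1 \<longrightarrow> z \<in> V)"
    if V: "openin T V" "x \<in> V" for V x
  proof -
    obtain V' where V': "openin X V'" "V = V' \<inter> G"
      using V(1) unfolding T_def openin_subtopology by blast
    then have "x \<in> V'" using V(2) by blast
    from completely_regular_nbhd[OF cr V'(1) this] obtain f where
      "continuous_map X euclideanreal f" "f x = 0" "\<forall>z\<in>topspace X. \<bar>f z\<bar> < 1 \<longrightarrow> z \<in> V'"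
      by (elim exE conjE) (rule that)
    then show ?thesis using V'(2) GX by (intro exI[of _ f]) auto
  qed
  have mult: "continuous_map (prod_topology T T) T (\<lambda>(x, y). x \<otimes>\<^bsub>R\<^esub> y)"
    unfolding continuous_map_eq_topcontinuous_at topcontinuous_at_def
  proof (intro ballI conjI allI impI)
    fix p assume p: "p \<in> topspace (prod_topology T T)"
    then obtain g h where gh: "p = (g, h)" "g \<in> G" "h \<in> G" by (auto simp: topT)
    show "p \<in> topspace (prod_topology T T)" by fact
    show "(\<lambda>(x, y). x \<otimes>\<^bsub>R\<^esub> y) \<in> topspace (prod_topology T T) \<rightarrow> topspace T"
      using mG by (auto simp: topT)
    fix V assume V: "openin T V \<and> (case p of (x, y) \<Rightarrow> x \<otimes>\<^bsub>R\<^esub> y) \<in> V"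
    then obtain f where f: "continuous_map X euclideanreal f" "f (g \<otimes>\<^bsub>R\<^esub> h) = 0"
      "\<And>z. z \<in> G \<Longrightarrow> \<bar>f z\<bar> < 1 \<Longrightarrow> z \<in> V"
      using nbhd[of V "g \<otimes>\<^bsub>R\<^esub> h"] unfolding gh(1) by auto
    obtain N where N: "openin T N" "e \<in> N" "\<And>u y. u \<in> N \<Longrightarrow> y \<in> G \<Longrightarrow> \<bar>f (u \<otimes>\<^bsub>R\<^esub> y) - f y\<bar> \<le> 1 / 2"
      using equi[OF f(1), of "1/2"] by auto
    \<comment> \<open>The product \<open>xy\<close> is split as \<open>x\<close> times the inverse
      of \<open>g\<close>, followed by \<open>gy\<close>. The first factor is near \<open>e\<close>
      and changes \<open>f\<close> by at most 1/2 uniformly in \<open>y\<close>; the set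
      \<open>B\<close> makes the absolute value of \<open>f(gy)\<close> less than 1/2.\<close>
    define A where "A = {x \<in> topspace T. x \<otimes>\<^bsub>R\<^esub> inv\<^bsub>R\<^esub> g \<in> N}"
    define B where "B = {y \<in> topspace T. f (g \<otimes>\<^bsub>R\<^esub> y) \<in> ball 0 (1/2)}"
    have ig: "inv\<^bsub>R\<^esub> g \<in> G" using gh(2) by (rule iG)
    have "openin T A"
      unfolding A_def using rcont[OF ig] N(1) by (rule openin_continuous_map_preimage)
    moreover have "openin T B"
    proof -
      have "continuous_map T euclideanreal f"
        unfolding T_def by (rule continuous_map_from_subtopology[OF f(1)])
      then have "continuous_map T euclideanreal (\<lambda>y. f (g \<otimes>\<^bsub>R\<^esub> y))"
        using continuous_map_compose[OF lcont[OF gh(2)]] by (simp add: o_def)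
      then show ?thesis unfolding B_def by (rule openin_continuous_map_preimage) simp
    qed
    moreover have "g \<in> A" "h \<in> B"
      using gh N(2) f(2) R.r_inv[unfolded R(1,3), OF gh(2)] by (auto simp: A_def B_def topT)
    moreover have "x \<otimes>\<^bsub>R\<^esub> y \<in> V" if "x \<in> A" "y \<in> B" for x y
    proof (rule f(3))
      have c: "x \<in> carrier R" "y \<in> carrier R" "g \<in> carrier R"
        using that gh by (auto simp: A_def B_def topT R(1))
      then show "x \<otimes>\<^bsub>R\<^esub> y \<in> G" by (simp add: R(1) mG)
      have "x \<otimes>\<^bsub>R\<^esub> inv\<^bsub>R\<^esub> g \<otimes>\<^bsub>R\<^esub> (g \<otimes>\<^bsub>R\<^esub> y) = x \<otimes>\<^bsub>R\<^esub> y"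
        using c by (simp add: R.m_assoc flip: R.m_assoc[of "inv\<^bsub>R\<^esub> g"])
      moreover have "g \<otimes>\<^bsub>R\<^esub> y \<in> G" using c by (simp add: R(1) mG)
      ultimately have "\<bar>f (x \<otimes>\<^bsub>R\<^esub> y) - f (g \<otimes>\<^bsub>R\<^esub> y)\<bar> \<le> 1 / 2"
        using N(3)[of "x \<otimes>\<^bsub>R\<^esub> inv\<^bsub>R\<^esub> g" "g \<otimes>\<^bsub>R\<^esub> y"] that(1) by (simp add: A_def)
      moreover have "\<bar>f (g \<otimes>\<^bsub>R\<^esub> y)\<bar> < 1 / 2"
        using that(2) by (simp add: B_def)
      ultimately show "\<bar>f (x \<otimes>\<^bsub>R\<^esub> y)\<bar> < 1" by linarith
    qed
    ultimately show "\<exists>U. openin (prod_topology T T) U \<and> p \<in> U \<and>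
        (\<forall>q\<in>U. (case q of (x, y) \<Rightarrow> x \<otimes>\<^bsub>R\<^esub> y) \<in> V)"
      by (intro exI[of _ "A \<times> B"]) (auto simp: gh(1) openin_prod_Times_iff)
  qed
  have inv: "continuous_map T T (\<lambda>x. inv\<^bsub>R\<^esub> x)"
    unfolding continuous_map_eq_topcontinuous_at topcontinuous_at_def
  proof (intro ballI conjI allI impI)
    fix g assume "g \<in> topspace T"
    then show "g \<in> topspace T" .
    then have g: "g \<in> G" by (simp add: topT)
    show "(\<lambda>x. inv\<^bsub>R\<^esub> x) \<in> topspace T \<rightarrow> topspace T"
      using iG by (auto simp: topT)
    fix V assume V: "openin T V \<and> inv\<^bsub>R\<^esub> g \<in> V"
    then obtain f where f: "continuous_map X euclideanreal f" "f (inv\<^bsub>R\<^esub> g) = 0"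
      "\<And>z. z \<in> G \<Longrightarrow> \<bar>f z\<bar> < 1 \<Longrightarrow> z \<in> V"
      using nbhd[of V "inv\<^bsub>R\<^esub> g"] by auto
    obtain N where N: "openin T N" "e \<in> N" "\<And>u y. u \<in> N \<Longrightarrow> y \<in> G \<Longrightarrow> \<bar>f (u \<otimes>\<^bsub>R\<^esub> y) - f y\<bar> \<le> 1 / 2"
      using equi[OF f(1), of "1/2"] by auto
    \<comment> \<open>For \<open>x \<in> A\<close> the product of \<open>u = inv g x\<close> and
      \<open>y = inv x\<close> is \<open>inv g\<close>, so the uniform estimate compares
      \<open>f\<close> at the two inverses directly.\<close>
    define A where "A = {x \<in> topspace T. inv\<^bsub>R\<^esub> g \<otimes>\<^bsub>R\<^esub> x \<in> N}"
    have ig: "inv\<^bsub>R\<^esub> g \<in> G" using g by (rule iG)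
    have "openin T A"
      unfolding A_def using lcont[OF ig] N(1) by (rule openin_continuous_map_preimage)
    moreover have "g \<in> A"
      using g N(2) R.l_inv[unfolded R(1,3), OF g] by (auto simp: A_def topT)
    moreover have "inv\<^bsub>R\<^esub> x \<in> V" if "x \<in> A" for x
    proof (rule f(3))
      have c: "x \<in> carrier R" "g \<in> carrier R"
        using that g by (auto simp: A_def topT R(1))
      then show "inv\<^bsub>R\<^esub> x \<in> G" by (simp add: R(1) iG)
      have "inv\<^bsub>R\<^esub> g \<otimes>\<^bsub>R\<^esub> x \<otimes>\<^bsub>R\<^esub> inv\<^bsub>R\<^esub> x = inv\<^bsub>R\<^esub> g"
        using c by (simp add: R.m_assoc)
      then have "\<bar>f (inv\<^bsub>R\<^esub> g) - f (inv\<^bsub>R\<^esub> x)\<bar> \<le> 1 / 2"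
        using N(3)[of "inv\<^bsub>R\<^esub> g \<otimes>\<^bsub>R\<^esub> x" "inv\<^bsub>R\<^esub> x"] that \<open>inv\<^bsub>R\<^esub> x \<in> G\<close> by (simp add: A_def)
      then show "\<bar>f (inv\<^bsub>R\<^esub> x)\<bar> < 1" using f(2) by linarith
    qed
    ultimately show "\<exists>U. openin T U \<and> g \<in> U \<and> (\<forall>y\<in>U. inv\<^bsub>R\<^esub> y \<in> V)" by blast
  qed
  show ?thesis
    using grp mult inv topT unfolding topological_group_def T_def R_def
    by (simp add: restrict_monoid_def)
qed

end
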